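(* Let $X=V(I)\subseteq\mathbb{P}^n$ and $Y=V(J)\subseteq\mathbb{P}^m$ be two normal well-poised varieties over $\mathbb{C}$. Then the Segre embedding $X\times Y\subseteq\mathbb{P}^{(n+1)(m+1)-1}$ is well-poised. That is, the kernel $K\subseteq\mathbb{C}[z_{ij}:0\le i\le n,\ 0\le j\le m]$ of the map $z_{ij}\mapsto x_iy_j$ to $\mathbb{C}[x_0,\dots,x_n,y_0,\dots,y_m]/(I+J)$ is well-poised.
   Context: For $w$ real, $\mathrm{in}_w(f)$ is the sum of terms of $f$ of minimal $w$-weight, $\mathrm{in}_w(I)=\langle\mathrm{in}_w(f):f\in I\rangle$, and $\mathrm{Trop}(I)$ is the set of $w$ such that $\mathrm{in}_w(I)$ contains no monomial. A prime ideal $I$ of a polynomial ring over $\mathbb{C}$ containing no variable is well-poised if $\mathrm{in}_w(I)$ is prime for every $w\in\mathrm{Trop}(I)$. A projective variety $V(I)\subseteq\mathbb{P}^n$, not contained in a coordinate hyperplane, with $I$ its homogeneous prime ideal, is well-poised if $I\subseteq\mathbb{C}[x_0,\dots,x_n]$ is well-poised. *)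

theory Defs
  imports
    Complex_Main
    "HOL-Library.Poly_Mapping"
    "HOL-Algebra.QuotRing"
    "HOL-Decision_Procs.Algebra_Aux"
begin

section \<open>Polynomials over the complex numbers\<close>

text \<open>
  Polynomials in variables indexed by a type are finitely supported functions from exponent
  vectors to coefficients. If \<open>'v\<close> has \<open>n + 1\<close> elements, the type below is
  \<open>\<complex>[x\<^sub>0, \<dots>, x\<^sub>n]\<close>.
\<close>

type_synonym 'v cpoly = "('v \<Rightarrow>\<^sub>0 nat) \<Rightarrow>\<^sub>0 complex"

abbreviation cpoly_ring :: "'v cpoly ring"
  where "cpoly_ring \<equiv> cring_class_ops"

definition monom_poly :: "('v \<Rightarrow>\<^sub>0 nat) \<Rightarrow> 'v cpoly"
  where "monom_poly m = Poly_Mapping.single m 1"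

definition var_poly :: "'v \<Rightarrow> 'v cpoly"
  where "var_poly v = monom_poly (Poly_Mapping.single v 1)"

text \<open>\<open>c\<close> embeds the coefficients into the target ring and \<open>h v\<close> is the image of the variable \<open>v\<close>.\<close>

definition eval_hom :: "(complex \<Rightarrow> 'r::comm_ring_1) \<Rightarrow> ('v \<Rightarrow> 'r) \<Rightarrow> 'v cpoly \<Rightarrow> 'r"
  where "eval_hom c h f =
    (\<Sum>m\<in>Poly_Mapping.keys f. c (Poly_Mapping.lookup f m) *
       (\<Prod>v\<in>Poly_Mapping.keys m. h v ^ Poly_Mapping.lookup m v))"

definition poly_at :: "('v \<Rightarrow> complex) \<Rightarrow> 'v cpoly \<Rightarrow> complex"
  where "poly_at p = eval_hom (\<lambda>a. a) p"

definition poly_subst :: "('v \<Rightarrow> 'u cpoly) \<Rightarrow> 'v cpoly \<Rightarrow> 'u cpoly"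
  where "poly_subst h = eval_hom (Poly_Mapping.single 0) h"

definition homogeneous_of_degree :: "nat \<Rightarrow> 'v cpoly \<Rightarrow> bool"
  where "homogeneous_of_degree d f \<longleftrightarrow>
    (\<forall>m\<in>Poly_Mapping.keys f. (\<Sum>v\<in>Poly_Mapping.keys m. Poly_Mapping.lookup m v) = d)"

definition homogeneous_ideal :: "'v cpoly set \<Rightarrow> bool"
  where "homogeneous_ideal I \<longleftrightarrow>
    (\<exists>G. (\<forall>g\<in>G. \<exists>d. homogeneous_of_degree d g) \<and> I = genideal cpoly_ring G)"


section \<open>Initial ideals, tropical varieties and well-poised ideals\<close>

definition weight :: "('v \<Rightarrow> real) \<Rightarrow> ('v \<Rightarrow>\<^sub>0 nat) \<Rightarrow> real"
  where "weight w m = (\<Sum>v\<in>Poly_Mapping.keys m. w v * real (Poly_Mapping.lookup m v))"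

definition initial_form :: "('v \<Rightarrow> real) \<Rightarrow> 'v cpoly \<Rightarrow> 'v cpoly"
  where "initial_form w f =
    (\<Sum>m | m \<in> Poly_Mapping.keys f \<and> (\<forall>m'\<in>Poly_Mapping.keys f. weight w m \<le> weight w m').
       Poly_Mapping.single m (Poly_Mapping.lookup f m))"

definition initial_ideal :: "('v \<Rightarrow> real) \<Rightarrow> 'v cpoly set \<Rightarrow> 'v cpoly set"
  where "initial_ideal w I = genideal cpoly_ring (initial_form w ` I)"

definition Trop :: "'v cpoly set \<Rightarrow> ('v \<Rightarrow> real) set"
  where "Trop I = {w. \<forall>m. monom_poly m \<notin> initial_ideal w I}"

definition well_poised :: "'v cpoly set \<Rightarrow> bool"
  where "well_poised I \<longleftrightarrow>
    primeideal I cpoly_ring \<and> (\<forall>v. var_poly v \<notin> I) \<and>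
    (\<forall>w\<in>Trop I. primeideal (initial_ideal w I) cpoly_ring)"

text \<open>
  A projective variety \<open>V(I)\<close> is represented by its homogeneous prime ideal \<open>I\<close>. It lies in no
  coordinate hyperplane iff \<open>I\<close> contains no variable, which is part of \<^const>\<open>well_poised\<close>.
\<close>

definition well_poised_variety :: "'v cpoly set \<Rightarrow> bool"
  where "well_poised_variety I \<longleftrightarrow> homogeneous_ideal I \<and> well_poised I"


section \<open>Fields of fractions\<close>

definition frac_rel :: "('a, 'b) ring_scheme \<Rightarrow> (('a \<times> 'a) \<times> ('a \<times> 'a)) set"
  where "frac_rel R =
    {((a, b), (c, d)). a \<in> carrier R \<and> b \<in> carrier R - {\<zero>\<^bsub>R\<^esub>} \<and>
       c \<in> carrier R \<and> d \<in> carrier R - {\<zero>\<^bsub>R\<^esub>} \<and> a \<otimes>\<^bsub>R\<^esub> d = c \<otimes>\<^bsub>R\<^esub> b}"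

definition mk_frac :: "('a, 'b) ring_scheme \<Rightarrow> 'a \<Rightarrow> 'a \<Rightarrow> ('a \<times> 'a) set"
  where "mk_frac R a b = frac_rel R `` {(a, b)}"

definition frac_field :: "('a, 'b) ring_scheme \<Rightarrow> ('a \<times> 'a) set ring"
  where "frac_field R =
    \<lparr>carrier = {mk_frac R a b |a b. a \<in> carrier R \<and> b \<in> carrier R - {\<zero>\<^bsub>R\<^esub>}},
     mult = (\<lambda>X Y. \<Union>(a, b)\<in>X. \<Union>(c, d)\<in>Y. mk_frac R (a \<otimes>\<^bsub>R\<^esub> c) (b \<otimes>\<^bsub>R\<^esub> d)),
     one = mk_frac R \<one>\<^bsub>R\<^esub> \<one>\<^bsub>R\<^esub>,
     zero = mk_frac R \<zero>\<^bsub>R\<^esub> \<one>\<^bsub>R\<^esub>,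
     add = (\<lambda>X Y. \<Union>(a, b)\<in>X. \<Union>(c, d)\<in>Y.
       mk_frac R (a \<otimes>\<^bsub>R\<^esub> d \<oplus>\<^bsub>R\<^esub> c \<otimes>\<^bsub>R\<^esub> b) (b \<otimes>\<^bsub>R\<^esub> d))\<rparr>"


section \<open>Normal projective varieties\<close>

definition integral_over :: "('a, 'b) ring_scheme \<Rightarrow> 'a set \<Rightarrow> 'a \<Rightarrow> bool"
  where "integral_over F A x \<longleftrightarrow>
    (\<exists>(N::nat) a. (\<forall>k<N. a k \<in> A) \<and>
       x [^]\<^bsub>F\<^esub> N \<oplus>\<^bsub>F\<^esub> (\<Oplus>\<^bsub>F\<^esub>k\<in>{..<N}. a k \<otimes>\<^bsub>F\<^esub> x [^]\<^bsub>F\<^esub> k) = \<zero>\<^bsub>F\<^esub>)"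

text \<open>Points of \<open>V(I)\<close> are given by homogeneous coordinate vectors.\<close>

definition proj_points :: "'v cpoly set \<Rightarrow> ('v \<Rightarrow> complex) set"
  where "proj_points I = {p. (\<exists>v. p v \<noteq> 0) \<and> (\<forall>f\<in>I. poly_at p f = 0)}"

text \<open>
  The field of fractions of the homogeneous coordinate ring; the function field of \<open>V(I)\<close> and the
  local rings at its points are the subrings of quotients \<open>f / g\<close> of forms of equal degree.
\<close>

definition coord_frac_field :: "'v cpoly set \<Rightarrow> ('v cpoly set \<times> 'v cpoly set) set ring"
  where "coord_frac_field I = frac_field (cpoly_ring Quot I)"

definition coord_frac ::
    "'v cpoly set \<Rightarrow> 'v cpoly \<Rightarrow> 'v cpoly \<Rightarrow> ('v cpoly set \<times> 'v cpoly set) set"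
  where "coord_frac I f g =
    mk_frac (cpoly_ring Quot I) (I +>\<^bsub>cpoly_ring\<^esub> f) (I +>\<^bsub>cpoly_ring\<^esub> g)"

definition function_field :: "'v cpoly set \<Rightarrow> ('v cpoly set \<times> 'v cpoly set) set set"
  where "function_field I =
    {coord_frac I f g |f g d.
       homogeneous_of_degree d f \<and> homogeneous_of_degree d g \<and> g \<notin> I}"

text \<open>For \<open>p \<in> V(I)\<close> the condition \<open>g(p) \<noteq> 0\<close> implies \<open>g \<notin> I\<close>.\<close>

definition local_ring ::
    "'v cpoly set \<Rightarrow> ('v \<Rightarrow> complex) \<Rightarrow> ('v cpoly set \<times> 'v cpoly set) set set"
  where "local_ring I p =
    {coord_frac I f g |f g d.
       homogeneous_of_degree d f \<and> homogeneous_of_degree d g \<and> poly_at p g \<noteq> 0}"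

definition normal_variety :: "'v cpoly set \<Rightarrow> bool"
  where "normal_variety I \<longleftrightarrow>
    (\<forall>p\<in>proj_points I. \<forall>x\<in>function_field I.
       integral_over (coord_frac_field I) (local_ring I p) x \<longrightarrow> x \<in> local_ring I p)"


section \<open>Segre embeddings\<close>

text \<open>
  The variables \<open>x\<^sub>i\<close> and \<open>y\<^sub>j\<close> of \<open>\<complex>[x, y]\<close> are indexed by \<^term>\<open>Inl i\<close> and \<^term>\<open>Inr j\<close>.
  The ideal below is the sum of the extensions of \<open>I\<close> and \<open>J\<close> to \<open>\<complex>[x, y]\<close>.
\<close>

definition sum_ideal :: "'n cpoly set \<Rightarrow> 'm cpoly set \<Rightarrow> ('n + 'm) cpoly set"
  where "sum_ideal I J =
    genideal cpoly_ring (poly_subst (\<lambda>i. var_poly (Inl i)) ` I)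
      <+>\<^bsub>cpoly_ring\<^esub> genideal cpoly_ring (poly_subst (\<lambda>j. var_poly (Inr j)) ` J)"

definition segre_subst :: "('n \<times> 'm) cpoly \<Rightarrow> ('n + 'm) cpoly"
  where "segre_subst = poly_subst (\<lambda>(i, j). var_poly (Inl i) * var_poly (Inr j))"

definition segre_ideal :: "'n cpoly set \<Rightarrow> 'm cpoly set \<Rightarrow> ('n \<times> 'm) cpoly set"
  where "segre_ideal I J =
    a_kernel cpoly_ring (cpoly_ring Quot sum_ideal I J)
      (\<lambda>f. sum_ideal I J +>\<^bsub>cpoly_ring\<^esub> segre_subst f)"

end

theory Submission
  imports Defs
    "HOL-Analysis.Continuum_Not_Denumerable"
    "HOL-Computational_Algebra.Fundamental_Theorem_Algebra"
begin

text \<open>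
  Write \<open>K\<close> for the Segre ideal and \<open>\<sigma>\<close> for the homomorphism \<open>z\<^sub>i\<^sub>j \<mapsto> x\<^sub>i y\<^sub>j\<close>, so that \<open>K\<close> is the
  preimage under \<open>\<sigma>\<close> of the ideal \<open>I + J\<close> of \<open>\<complex>[x, y]\<close>. The proof rests on three facts.

  First, over an algebraically closed field the sum of a prime ideal in the variables \<open>x\<close> and a
  prime ideal in the variables \<open>y\<close> is prime (\<open>primeideal_sum_ideal\<close>). Points detect this: if \<open>f\<close> is
  not in \<open>P + Q\<close>, then for all points \<open>p\<close> of a nonempty open subset of \<open>V(P)\<close> the polynomial
  \<open>f(p, y)\<close> is not in \<open>Q\<close>; and two nonempty open subsets of the irreducible variety \<open>V(P)\<close> meet.
  That \<open>V(P)\<close> has enough points is the Nullstellensatz, obtained here from the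
  uncountability of \<open>\<complex>\<close>: a finitely generated \<open>\<complex>\<close>-algebra has countable dimension, whereas the
  fractions \<open>1 / (x - c)\<close> with \<open>x\<close> transcendental would be uncountably many independent elements.

  Second, weights of the form \<open>w\<^sub>i\<^sub>j = u\<^sub>i + v\<^sub>j\<close> satisfy
  \<open>in\<^sub>w(K) = \<sigma>\<^sup>-\<^sup>1(in\<^sub>u(I) + in\<^sub>v(J))\<close> (\<open>initial_segre_ideal\<close>). For such weights \<open>\<sigma>\<close> preserves the
  weight of monomials. The inclusion from left to right says that the lowest-weight part of an
  element of \<open>I + J\<close> lies in \<open>in\<^sub>u(I) + in\<^sub>v(J)\<close>, even when it is exposed only by a cancellation of
  terms of lower weight (\<open>part_sum_ideal\<close>). The reason is that the quotients by \<open>I\<close> and by \<open>J\<close> have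
  bases of standard monomials, and reduction to these bases never lowers weights. The other
  inclusion lifts monomials of bidegree \<open>(d, d)\<close> back to \<open>\<complex>[z]\<close>; two lifts of the same monomial
  differ by a binomial in \<open>K\<close> whose two terms have equal weight.

  Third, every tropical point of \<open>K\<close> has this form with \<open>u\<close> and \<open>v\<close> tropical points of \<open>I\<close> and \<open>J\<close>.
  The binomials \<open>z\<^sub>i\<^sub>j z\<^sub>k\<^sub>l - z\<^sub>i\<^sub>l z\<^sub>k\<^sub>j\<close> of \<open>K\<close> must not have a monomial as initial form, which forces
  \<open>w\<^sub>i\<^sub>j = u\<^sub>i + v\<^sub>j\<close>; and a monomial of degree \<open>d\<close> in \<open>in\<^sub>u(I)\<close>, multiplied by a monomial of degree \<open>d\<close>
  in \<open>y\<close>, lifts to a monomial in \<open>in\<^sub>w(K)\<close>.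

  Hence for a tropical point \<open>w\<close> of \<open>K\<close> the ideals \<open>in\<^sub>u(I)\<close> and \<open>in\<^sub>v(J)\<close> are prime, so is their sum, and
  so is its preimage \<open>in\<^sub>w(K)\<close>.
\<close>

abbreviation "lookup \<equiv> Poly_Mapping.lookup"
abbreviation "keys \<equiv> Poly_Mapping.keys"
abbreviation "single \<equiv> Poly_Mapping.single"

section \<open>Ideals in type-class rings\<close>

lemma ideal_class_iff:
  "ideal I (cring_class_ops :: 'a::comm_ring_1 ring) \<longleftrightarrow>
    0 \<in> I \<and> (\<forall>a\<in>I. \<forall>b\<in>I. a + b \<in> I) \<and> (\<forall>a\<in>I. \<forall>r. r * a \<in> I)"
proof
  assume "ideal I (cring_class_ops :: 'a ring)"
  then interpret ideal I "cring_class_ops :: 'a ring" .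
  show "0 \<in> I \<and> (\<forall>a\<in>I. \<forall>b\<in>I. a + b \<in> I) \<and> (\<forall>a\<in>I. \<forall>r. r * a \<in> I)"
    using zero_closed a_closed I_l_closed by (auto simp: class_simps)
next
  assume *: "0 \<in> I \<and> (\<forall>a\<in>I. \<forall>b\<in>I. a + b \<in> I) \<and> (\<forall>a\<in>I. \<forall>r. r * a \<in> I)"
  have neg: "- a \<in> I" if "a \<in> I" for a
    using * that by (metis mult_minus1)
  show "ideal I (cring_class_ops :: 'a ring)"
  proof (rule idealI)
    show "ring (cring_class_ops :: 'a ring)"
      by (rule cring.axioms(1)[OF cring_class])
    show "subgroup I (add_monoid (cring_class_ops :: 'a ring))"
    proof (intro subgroup.intro)
      fix x assume "x \<in> I"
      then show "inv\<^bsub>add_monoid cring_class_ops\<^esub> x \<in> I"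
        unfolding a_inv_def[symmetric] uminus_class by (rule neg)
    qed (use * in \<open>auto simp: class_simps\<close>)
  qed (use * in \<open>auto simp: class_simps mult.commute\<close>)
qed

lemma ideal_zero: "ideal I (cring_class_ops :: 'a::comm_ring_1 ring) \<Longrightarrow> 0 \<in> I"
  and ideal_add: "ideal I (cring_class_ops :: 'a::comm_ring_1 ring) \<Longrightarrow> a \<in> I \<Longrightarrow> b \<in> I \<Longrightarrow> a + b \<in> I"
  and ideal_mult: "ideal I (cring_class_ops :: 'a::comm_ring_1 ring) \<Longrightarrow> a \<in> I \<Longrightarrow> r * a \<in> I"
  by (auto simp: ideal_class_iff)

lemma ideal_mult_right: "ideal I (cring_class_ops :: 'a::comm_ring_1 ring) \<Longrightarrow> a \<in> I \<Longrightarrow> a * r \<in> I"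
  using ideal_mult[of I a r] by (simp add: mult.commute)

lemma ideal_uminus: "ideal I (cring_class_ops :: 'a::comm_ring_1 ring) \<Longrightarrow> a \<in> I \<Longrightarrow> - a \<in> I"
  using ideal_mult[of I a "-1"] by simp

lemma ideal_diff:
  "ideal I (cring_class_ops :: 'a::comm_ring_1 ring) \<Longrightarrow> a \<in> I \<Longrightarrow> b \<in> I \<Longrightarrow> a - b \<in> I"
  using ideal_add[of I a "- b"] ideal_uminus[of I b] by simp

lemma ideal_sum:
  "ideal I (cring_class_ops :: 'a::comm_ring_1 ring) \<Longrightarrow> (\<And>x. x \<in> A \<Longrightarrow> f x \<in> I) \<Longrightarrow> sum f A \<in> I"
  by (induction A rule: infinite_finite_induct) (auto intro: ideal_zero ideal_add)

lemma ideal_cong: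
  assumes "ideal I (cring_class_ops :: 'a::comm_ring_1 ring)" "a - b \<in> I"
  shows "a \<in> I \<longleftrightarrow> b \<in> I"
  using ideal_add[OF assms(1,2), of b] ideal_diff[OF assms(1) _ assms(2), of a] by auto

lemma primeideal_class_iff:
  "primeideal I (cring_class_ops :: 'a::comm_ring_1 ring) \<longleftrightarrow>
    ideal I cring_class_ops \<and> 1 \<notin> I \<and> (\<forall>a b. a * b \<in> I \<longrightarrow> a \<in> I \<or> b \<in> I)"
proof
  assume "primeideal I (cring_class_ops :: 'a ring)"
  then interpret primeideal I "cring_class_ops :: 'a ring" .
  have "1 \<notin> I"
    using I_notcarr one_imp_carrier by (auto simp: class_simps)
  then show "ideal I cring_class_ops \<and> 1 \<notin> I \<and> (\<forall>a b. a * b \<in> I \<longrightarrow> a \<in> I \<or> b \<in> I)"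
    using I_prime is_ideal by (auto simp: class_simps)
next
  assume *: "ideal I cring_class_ops \<and> 1 \<notin> I \<and> (\<forall>a b. a * b \<in> I \<longrightarrow> a \<in> I \<or> b \<in> I)"
  then show "primeideal I (cring_class_ops :: 'a ring)"
    by (intro primeidealI) (auto simp: class_simps cring_class)
qed

lemma ideal_genideal: "ideal (genideal cring_class_ops S) (cring_class_ops :: 'a::comm_ring_1 ring)"
  by (rule ring.genideal_ideal[OF cring.axioms(1)[OF cring_class]]) (auto simp: class_simps)

lemma subset_genideal: "S \<subseteq> genideal (cring_class_ops :: 'a::comm_ring_1 ring) S"
  by (auto simp: genideal_def)

lemma genideal_subset:
  "ideal I (cring_class_ops :: 'a::comm_ring_1 ring) \<Longrightarrow> S \<subseteq> I \<Longrightarrow> genideal cring_class_ops S \<subseteq> I"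
  by (auto simp: genideal_def)

lemma genideal_mono:
  "A \<subseteq> B \<Longrightarrow> genideal (cring_class_ops :: 'a::comm_ring_1 ring) A \<subseteq> genideal cring_class_ops B"
  by (rule genideal_subset[OF ideal_genideal subset_trans[OF _ subset_genideal]])

lemma in_genideal: "s \<in> S \<Longrightarrow> s \<in> genideal (cring_class_ops :: 'a::comm_ring_1 ring) S"
  using subset_genideal by auto

section \<open>Polynomials as linear combinations of monomials\<close>

lemma cpoly_sum:
  fixes f :: "'v cpoly"
  shows "f = (\<Sum>m\<in>keys f. single m (lookup f m))"
proof (rule poly_mapping_eqI)
  fix k
  show "lookup f k = lookup (\<Sum>m\<in>keys f. single m (lookup f m)) k"
    by (cases "k \<in> keys f")
      (auto simp: lookup_sum lookup_single when_def in_keys_iff)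
qed

lemma cpoly_induct [case_names zero single add]:
  fixes f :: "'v cpoly"
  assumes "P 0" "\<And>m c. P (single m c)" "\<And>f g. P f \<Longrightarrow> P g \<Longrightarrow> P (f + g)"
  shows "P f"
proof -
  have "P (\<Sum>m\<in>A. single m (lookup f m))" for A
    by (induction A rule: infinite_finite_induct) (auto intro: assms)
  then show ?thesis using cpoly_sum[of f] by metis
qed

lemma exponent_induct [case_names zero single add]:
  fixes m :: "'v \<Rightarrow>\<^sub>0 nat"
  assumes "P 0" "\<And>v. P (single v 1)" "\<And>a b. P a \<Longrightarrow> P b \<Longrightarrow> P (a + b)"
  shows "P m"
proof -
  have *: "P (single v k)" for v k
  proof (induction k)
    case (Suc k)
    have "single v (Suc k) = single v 1 + single v k" by (simp add: single_add[symmetric])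
    then show ?case using assms Suc by metis
  qed (simp add: assms)
  have "P (\<Sum>v\<in>A. single v (lookup m v))" for A
    by (induction A rule: infinite_finite_induct) (auto intro: assms *)
  moreover have "m = (\<Sum>v\<in>keys m. single v (lookup m v))"
    by (rule poly_mapping_eqI) (auto simp: lookup_sum lookup_single when_def in_keys_iff)
  ultimately show ?thesis by metis
qed

lemma cpoly_ring_induct [case_names const var add mult]:
  fixes f :: "'v cpoly"
  assumes const: "\<And>c. P (single 0 c)" and var: "\<And>v. P (var_poly v)"
    and add: "\<And>f g. P f \<Longrightarrow> P g \<Longrightarrow> P (f + g)" and mult: "\<And>f g. P f \<Longrightarrow> P g \<Longrightarrow> P (f * g)"
  shows "P f"
proof -
  have m: "P (single m 1)" for m :: "'v \<Rightarrow>\<^sub>0 nat"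
  proof (induction m rule: exponent_induct)
    case (single v)
    then show ?case using var[of v] by (simp add: var_poly_def monom_poly_def)
  next
    case (add a b)
    then show ?case using mult[of "single a 1" "single b 1"] by (simp add: mult_single)
  qed (rule const)
  show ?thesis
  proof (induction f rule: cpoly_induct)
    case (single m c)
    then show ?case using mult[OF const[of c] m[of m]] by (simp add: mult_single)
  qed (use const[of 0] in \<open>auto intro: add\<close>)
qed

text \<open>
  Multiples by single terms suffice because every multiplier is a sum of terms. This is the form in
  which gradings and linear maps that are defined on monomials can be applied to an ideal.
\<close>

lemma genideal_induct [consumes 1, case_names zero add mult]:
  assumes f: "f \<in> genideal (cpoly_ring :: 'v cpoly ring) S"
    and zero: "P 0" and add: "\<And>f g. P f \<Longrightarrow> P g \<Longrightarrow> P (f + g)"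
    and gen: "\<And>m c s. s \<in> S \<Longrightarrow> P (single m c * s)"
  shows "P f"
proof -
  define T where "T = {f. \<forall>h. P (h * f)}"
  have "ideal T (cpoly_ring :: 'v cpoly ring)"
    unfolding ideal_class_iff
    by (auto simp: T_def zero distrib_left add mult.assoc[symmetric])
  moreover have "S \<subseteq> T"
  proof
    fix s assume s: "s \<in> S"
    have "P (h * s)" for h
      by (induction h rule: cpoly_induct) (auto simp: zero gen s distrib_right add)
    then show "s \<in> T" by (simp add: T_def)
  qed
  ultimately have "f \<in> T" using genideal_subset f by blast
  then have "P (1 * f)" unfolding T_def by blast
  then show ?thesis by simp
qed

subsection \<open>Linear extensions\<close>

text \<open>
  The map \<open>c\<close> is the structure map of the target as a \<open>\<complex>\<close>-algebra. Evaluation homomorphisms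
  are the case in which \<open>g\<close> is multiplicative; normal forms and lifts are linear maps of the same
  shape that are not homomorphisms.
\<close>

definition lin_ext :: "(complex \<Rightarrow> 'r) \<Rightarrow> ('a \<Rightarrow> 'r::comm_ring_1) \<Rightarrow> ('a \<Rightarrow>\<^sub>0 complex) \<Rightarrow> 'r"
  where "lin_ext c g f = (\<Sum>m\<in>keys f. c (lookup f m) * g m)"

locale coeff_map =
  fixes c :: "complex \<Rightarrow> 'r::comm_ring_1"
  assumes c_add: "c (a + b) = c a + c b" and c_one: "c 1 = 1" and c_mult: "c (a * b) = c a * c b"
begin

lemma c_zero: "c 0 = 0"
  using c_add[of 0 0] by simp

lemma lin_ext_superset:
  assumes "finite A" "keys f \<subseteq> A"
  shows "lin_ext c g f = (\<Sum>m\<in>A. c (lookup f m) * g m)"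
  unfolding lin_ext_def using assms
  by (intro sum.mono_neutral_left) (auto simp: in_keys_iff c_zero)

lemma lin_ext_zero: "lin_ext c g 0 = 0"
  by (simp add: lin_ext_def)

lemma lin_ext_single: "lin_ext c g (single m a) = c a * g m"
  by (simp add: lin_ext_def c_zero)

lemma lin_ext_add: "lin_ext c g (f + f') = lin_ext c g f + lin_ext c g f'"
proof -
  let ?A = "keys f \<union> keys f'"
  have "keys (f + f') \<subseteq> ?A" by (rule keys_add)
  then show ?thesis
    by (simp add: lin_ext_superset[of ?A] lookup_add c_add distrib_right sum.distrib)
qed

lemma lin_ext_mult:
  fixes f f' :: "'v cpoly"
  assumes "\<And>a b. g (a + b) = g a * g b"
  shows "lin_ext c g (f * f') = lin_ext c g f * lin_ext c g f'"
proof (induction f rule: cpoly_induct)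
  case (single m a)
  show ?case
    by (induction f' rule: cpoly_induct)
      (simp_all add: lin_ext_zero lin_ext_add ring_distribs mult_single lin_ext_single c_mult assms mult_ac)
qed (simp_all add: lin_ext_zero lin_ext_add distrib_right)

end

definition monom_eval :: "('v \<Rightarrow> 'r::comm_ring_1) \<Rightarrow> ('v \<Rightarrow>\<^sub>0 nat) \<Rightarrow> 'r"
  where "monom_eval h m = (\<Prod>v\<in>keys m. h v ^ lookup m v)"

lemma monom_eval_add: "monom_eval h (a + b) = monom_eval h a * monom_eval h b"
proof -
  let ?A = "keys a \<union> keys b"
  have *: "monom_eval h m = (\<Prod>v\<in>?A. h v ^ lookup m v)" if "keys m \<subseteq> ?A" for m
    unfolding monom_eval_def using that
    by (intro prod.mono_neutral_left) (auto simp: in_keys_iff)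
  show ?thesis
    using keys_add[of a b] by (simp add: * lookup_add power_add prod.distrib)
qed

lemma eval_hom_lin_ext: "eval_hom c h = lin_ext c (monom_eval h)"
  by (simp add: eval_hom_def lin_ext_def monom_eval_def fun_eq_iff)

context coeff_map begin

lemma eval_hom_zero: "eval_hom c h 0 = 0"
  and eval_hom_add: "eval_hom c h (f + g) = eval_hom c h f + eval_hom c h g"
  and eval_hom_mult: "eval_hom c h (f * g :: 'v cpoly) = eval_hom c h f * eval_hom c h g"
  and eval_hom_const: "eval_hom c h (single 0 a) = c a"
  and eval_hom_var: "eval_hom c h (var_poly v) = h v"
  and eval_hom_one: "eval_hom c h 1 = 1"
proof -
  show const: "eval_hom c h (single 0 a) = c a" for a
    by (simp add: eval_hom_lin_ext lin_ext_single monom_eval_def)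
  show "eval_hom c h 1 = 1"
    using const[of 1] by (simp add: c_one)
  show "eval_hom c h (f * g) = eval_hom c h f * eval_hom c h g"
    unfolding eval_hom_lin_ext by (rule lin_ext_mult[OF monom_eval_add])
qed (simp_all add: eval_hom_lin_ext lin_ext_zero lin_ext_add
    var_poly_def monom_poly_def lin_ext_single c_one monom_eval_def)

lemma eval_hom_uminus: "eval_hom c h (- f) = - eval_hom c h f"
  using eval_hom_add[of h f "- f"] by (simp add: eval_hom_zero eq_neg_iff_add_eq_0 add.commute)

lemma eval_hom_diff: "eval_hom c h (f - g) = eval_hom c h f - eval_hom c h g"
  using eval_hom_add[of h f "- g"] by (simp add: eval_hom_uminus)

lemma eval_hom_sum: "eval_hom c h (sum f A) = (\<Sum>x\<in>A. eval_hom c h (f x))"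
  by (induction A rule: infinite_finite_induct) (simp_all add: eval_hom_zero eval_hom_add)

end

interpretation subst: coeff_map "single 0 :: complex \<Rightarrow> 'u cpoly"
  by unfold_locales (simp_all add: single_add mult_single)

interpretation pt: coeff_map "\<lambda>a::complex. a"
  by unfold_locales simp_all

lemmas poly_subst_simps =
  subst.eval_hom_zero[folded poly_subst_def] subst.eval_hom_one[folded poly_subst_def]
  subst.eval_hom_add[folded poly_subst_def] subst.eval_hom_mult[folded poly_subst_def]
  subst.eval_hom_const[folded poly_subst_def] subst.eval_hom_var[folded poly_subst_def]
  subst.eval_hom_uminus[folded poly_subst_def] subst.eval_hom_diff[folded poly_subst_def]
  subst.eval_hom_sum[folded poly_subst_def]

lemmas poly_at_simps =
  pt.eval_hom_zero[folded poly_at_def] pt.eval_hom_one[folded poly_at_def]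
  pt.eval_hom_add[folded poly_at_def] pt.eval_hom_mult[folded poly_at_def]
  pt.eval_hom_const[folded poly_at_def] pt.eval_hom_var[folded poly_at_def]
  pt.eval_hom_uminus[folded poly_at_def] pt.eval_hom_diff[folded poly_at_def]
  pt.eval_hom_sum[folded poly_at_def]

lemma poly_subst_monomial:
  assumes "\<And>a b. \<phi> (a + b) = \<phi> a + \<phi> b" and "\<phi> 0 = 0"
    and h: "\<And>v. h v = single (\<phi> (single v 1)) 1"
  shows "poly_subst h (single m c) = single (\<phi> m) c"
proof -
  have "poly_subst h (single m 1) = single (\<phi> m) 1"
  proof (induction m rule: exponent_induct)
    case zero
    then show ?case by (simp add: assms poly_subst_simps flip: single_one)
  next
    case (single v)
    have "poly_subst h (var_poly v) = h v" by (rule poly_subst_simps)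
    then show ?case unfolding var_poly_def monom_poly_def h .
  next
    case (add a b)
    have "single (a + b) (1::complex) = single a 1 * single b 1" by (simp add: mult_single)
    then have "poly_subst h (single (a + b) 1) = poly_subst h (single a 1) * poly_subst h (single b 1)"
      by (simp only: poly_subst_simps)
    also have "\<dots> = single (\<phi> (a + b)) 1" by (simp add: add mult_single assms)
    finally show ?case .
  qed
  then show ?thesis
    using poly_subst_simps(4)[of h "single 0 c" "single m 1"] poly_subst_simps(5)[of h c]
    by (simp add: mult_single)
qed

subsection \<open>Additive maps of exponents\<close>

text \<open>
  The homomorphism from the free commutative monoid of exponents that sends the variable \<open>v\<close> to
  \<open>e v\<close>; the inner sum is the multiple \<open>lookup m v \<cdot> e v\<close>. Weights, inclusions of variables and the
  Segre map on monomials are all of this kind.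
\<close>

definition exp_map :: "('v \<Rightarrow> 'b::comm_monoid_add) \<Rightarrow> ('v \<Rightarrow>\<^sub>0 nat) \<Rightarrow> 'b"
  where "exp_map e m = (\<Sum>v\<in>keys m. \<Sum>i<lookup m v. e v)"

lemma exp_map_zero: "exp_map e 0 = 0"
  and exp_map_single: "exp_map e (single v 1) = e v"
  by (simp_all add: exp_map_def)

lemma exp_map_add: "exp_map e (a + b) = exp_map e a + exp_map e b"
proof -
  let ?A = "keys a \<union> keys b"
  have *: "exp_map e m = (\<Sum>v\<in>?A. \<Sum>i<lookup m v. e v)" if "keys m \<subseteq> ?A" for m
    unfolding exp_map_def using that
    by (intro sum.mono_neutral_left) (auto simp: in_keys_iff)
  have **: "(\<Sum>i<j + k. e v) = (\<Sum>i<j. e v) + (\<Sum>i<k. e v)" for v and j k :: nat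
    by (induction k) (simp_all add: add_ac)
  show ?thesis
    using keys_add[of a b] by (simp add: * ** lookup_add sum.distrib)
qed

lemma weight_exp_map: "weight w m = exp_map w m"
  by (simp add: weight_def exp_map_def mult.commute)

lemma weight_zero: "weight w 0 = 0"
  and weight_single: "weight w (single v 1) = w v"
  and weight_add: "weight w (a + b) = weight w a + weight w b"
  unfolding weight_exp_map by (rule exp_map_zero exp_map_single exp_map_add)+

lemma exp_map_exp_map: "exp_map g (exp_map e m) = exp_map (\<lambda>v. exp_map g (e v)) m"
  by (induction m rule: exponent_induct)
    (simp_all add: exp_map_zero exp_map_single exp_map_add del: One_nat_def)

lemma weight_of_exp_map: "weight w (exp_map e m) = weight (\<lambda>v. weight w (e v)) m"
  unfolding weight_exp_map by (rule exp_map_exp_map)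

lemma poly_subst_single:
  "poly_subst (\<lambda>v. single (e v) 1) (single m c) = single (exp_map e m) c"
  by (rule poly_subst_monomial) (simp_all add: exp_map_add exp_map_zero exp_map_single del: One_nat_def)

subsection \<open>Graded pieces and orders with respect to a weight\<close>

definition part :: "('v \<Rightarrow> real) \<Rightarrow> real \<Rightarrow> 'v cpoly \<Rightarrow> 'v cpoly"
  where "part w k f = (\<Sum>m | m \<in> keys f \<and> weight w m = k. single m (lookup f m))"

lemma lookup_part: "lookup (part w k f) m = (if weight w m = k then lookup f m else 0)"
proof -
  have "lookup (part w k f) m =
      (\<Sum>m'\<in>{m' \<in> keys f. weight w m' = k}. if m' = m then lookup f m' else 0)"
    by (simp add: part_def lookup_sum lookup_single when_def)
  also have "\<dots> = (if weight w m = k then lookup f m else 0)"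
    by (subst sum.delta) (auto simp: in_keys_iff)
  finally show ?thesis .
qed

lemma part_zero: "part w k 0 = 0"
  and part_add: "part w k (f + g) = part w k f + part w k g"
  and part_diff: "part w k (f - g) = part w k f - part w k g"
  and part_uminus: "part w k (- f) = - part w k f"
  and part_single: "part w k (single m c) = (if weight w m = k then single m c else 0)"
  by (rule poly_mapping_eqI, simp add: lookup_part lookup_add lookup_minus lookup_single when_def)+

lemma part_sum: "part w k (sum f A) = (\<Sum>x\<in>A. part w k (f x))"
  by (induction A rule: infinite_finite_induct) (simp_all add: part_zero part_add)

lemma part_mult_single: "part w k (single a c * f) = single a c * part w (k - weight w a) f"
  by (induction f rule: cpoly_induct)
    (auto simp: part_zero part_add distrib_left mult_single part_single weight_add)

lemma lookup_const_mult:
  fixes f :: "'v cpoly"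
  shows "lookup (single 0 c * f) m = c * lookup f m"
  by (induction f rule: cpoly_induct)
    (simp_all add: distrib_left lookup_add mult_single lookup_single when_def)

lemma part_const_mult: "part w k (single 0 c * f) = single 0 c * part w k f"
  by (simp add: part_mult_single weight_zero)

lemma part_eq_self: "(\<And>m. m \<in> keys f \<Longrightarrow> weight w m = k) \<Longrightarrow> part w k f = f"
  by (rule poly_mapping_eqI) (auto simp: lookup_part in_keys_iff)

lemma keys_part: "keys (part w k f) = {m \<in> keys f. weight w m = k}"
  by (auto simp: in_keys_iff lookup_part split: if_splits)

lemma sum_parts: "f = (\<Sum>k\<in>weight w ` keys f. part w k f)"
  by (rule poly_mapping_eqI) (auto simp: lookup_sum lookup_part in_keys_iff sum.delta)

text \<open>
  Stated by vanishing of graded pieces rather than by exponents, so that it is inherited along every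
  linear map that commutes with \<^const>\<open>part\<close>.
\<close>

definition order_ge :: "('v \<Rightarrow> real) \<Rightarrow> real \<Rightarrow> 'v cpoly \<Rightarrow> bool"
  where "order_ge w \<mu> f \<longleftrightarrow> (\<forall>k<\<mu>. part w k f = 0)"

lemma order_ge_iff: "order_ge w \<mu> f \<longleftrightarrow> (\<forall>m\<in>keys f. \<mu> \<le> weight w m)"
proof
  assume *: "order_ge w \<mu> f"
  show "\<forall>m\<in>keys f. \<mu> \<le> weight w m"
  proof (intro ballI leI notI)
    fix m assume m: "m \<in> keys f" "weight w m < \<mu>"
    then have "lookup (part w (weight w m) f) m = 0"
      using * by (simp add: order_ge_def)
    then show False using m by (simp add: lookup_part in_keys_iff)
  qed
next
  assume *: "\<forall>m\<in>keys f. \<mu> \<le> weight w m"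
  show "order_ge w \<mu> f" unfolding order_ge_def
    using * by (force intro!: poly_mapping_eqI simp: lookup_part in_keys_iff)
qed

lemma order_ge_mult:
  assumes "order_ge w k f" "order_ge w l g"
  shows "order_ge w (k + l) (f * g)"
  using keys_mult[of f g] assms by (force simp: order_ge_iff weight_add intro: add_mono)

text \<open>Pieces of weight \<open>k + l\<close> can only come from the lowest pieces of both factors.\<close>

lemma part_mult:
  assumes "order_ge w k f" "order_ge w l g"
  shows "part w (k + l) (f * g) = part w k f * part w l g"
proof -
  have *: "part w (k + l) (single m (lookup f m) * g) = part w k (single m (lookup f m)) * part w l g"
    if "m \<in> keys f" for m
  proof (cases "weight w m = k")
    case False
    then have "k + l - weight w m < l"
      using assms(1) that by (force simp: order_ge_iff)
    then show ?thesis
      using assms(2) False by (simp add: part_mult_single part_single order_ge_def)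
  qed (simp add: part_mult_single part_single)
  have "part w (k + l) (f * g) = (\<Sum>m\<in>keys f. part w (k + l) (single m (lookup f m) * g))"
    by (subst cpoly_sum[of f]) (simp add: sum_distrib_right part_sum)
  also have "\<dots> = part w k (\<Sum>m\<in>keys f. single m (lookup f m)) * part w l g"
    by (simp add: * part_sum sum_distrib_right)
  finally show ?thesis using cpoly_sum[of f] by metis
qed

lemma part_linear:
  fixes T :: "'u cpoly \<Rightarrow> 'v cpoly"
  assumes "T 0 = 0" and "\<And>f g. T (f + g) = T f + T g"
    and "\<And>m c. part w' k (T (single m c)) = T (part w k (single m c))"
  shows "part w' k (T f) = T (part w k f)"
  by (induction f rule: cpoly_induct) (simp_all add: assms part_zero part_add)

lemma part_poly_subst:
  "part w k (poly_subst (\<lambda>v. single (e v) 1) f) =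
    poly_subst (\<lambda>v. single (e v) 1) (part (\<lambda>v. weight w (e v)) k f)"
  by (rule part_linear)
    (simp_all add: poly_subst_simps part_single poly_subst_single weight_of_exp_map)

subsection \<open>Ideals that are closed under taking graded pieces\<close>

text \<open>
  Multiplication by a term only shifts the weight, so that a piece of a multiple is the multiple of
  a piece.
\<close>

lemma genideal_part_closed:
  assumes S: "\<And>s k. s \<in> S \<Longrightarrow> part w k s \<in> genideal cpoly_ring S"
    and f: "f \<in> genideal cpoly_ring S"
  shows "part w k f \<in> genideal cpoly_ring S"
  using f
  by (induction f arbitrary: k rule: genideal_induct)
    (auto simp: part_zero part_add part_mult_single
      intro: ideal_zero ideal_add ideal_mult ideal_genideal S)

lemma homogeneous_of_degree_iff:
  "homogeneous_of_degree d f \<longleftrightarrow> (\<forall>m\<in>keys f. weight (\<lambda>_. 1) m = real d)"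
proof -
  have "weight (\<lambda>_. 1) m = real d \<longleftrightarrow> (\<Sum>v\<in>keys m. lookup m v) = d" for m :: "'a \<Rightarrow>\<^sub>0 nat"
    by (simp add: weight_def flip: of_nat_sum)
  then show ?thesis by (simp add: homogeneous_of_degree_def)
qed

text \<open>
  The total degree is treated as the weight with all entries \<open>1\<close>. Conversely, an ideal that
  contains the homogeneous parts of its elements is generated by them.
\<close>

lemma homogeneous_ideal_iff:
  "homogeneous_ideal I \<longleftrightarrow>
    ideal I cpoly_ring \<and> (\<forall>f\<in>I. \<forall>k. part (\<lambda>_. 1) k f \<in> I)"
proof
  assume "homogeneous_ideal I"
  then obtain G where G: "\<forall>g\<in>G. \<exists>d. homogeneous_of_degree d g" and I: "I = genideal cpoly_ring G"
    unfolding homogeneous_ideal_def by blast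
  have "part (\<lambda>_. 1) k g \<in> genideal cpoly_ring G" if g: "g \<in> G" for g k
  proof -
    from G g obtain d where "homogeneous_of_degree d g" by blast
    then have "part (\<lambda>_. 1) k g = g \<or> part (\<lambda>_. 1) k g = 0"
      by (cases "k = real d")
        (auto simp: homogeneous_of_degree_iff part_eq_self keys_part simp flip: keys_eq_empty)
    then show ?thesis using in_genideal[OF g] ideal_zero[OF ideal_genideal, of G] by auto
  qed
  then show "ideal I cpoly_ring \<and> (\<forall>f\<in>I. \<forall>k. part (\<lambda>_. 1) k f \<in> I)"
    unfolding I using ideal_genideal genideal_part_closed by blast
next
  assume *: "ideal I cpoly_ring \<and> (\<forall>f\<in>I. \<forall>k. part (\<lambda>_. 1) k f \<in> I)"
  define G where "G = {g \<in> I. \<exists>d. homogeneous_of_degree d g}"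
  have "f \<in> genideal cpoly_ring G" if f: "f \<in> I" for f
  proof -
    have "part (\<lambda>_. 1) (weight (\<lambda>_. 1) m) f \<in> G" for m
    proof -
      have "weight (\<lambda>_. 1) m = real (\<Sum>v\<in>keys m. lookup m v)" by (simp add: weight_def)
      then have "homogeneous_of_degree (\<Sum>v\<in>keys m. lookup m v) (part (\<lambda>_. 1) (weight (\<lambda>_. 1) m) f)"
        unfolding homogeneous_of_degree_iff keys_part by auto
      then show ?thesis using * f by (auto simp: G_def)
    qed
    then have "(\<Sum>k\<in>weight (\<lambda>_. 1) ` keys f. part (\<lambda>_. 1) k f) \<in> genideal cpoly_ring G"
      by (intro ideal_sum[OF ideal_genideal]) (auto intro: in_genideal)
    then show ?thesis using sum_parts[of f "\<lambda>_. 1"] by simp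
  qed
  moreover have "genideal cpoly_ring G \<subseteq> I"
    using * by (intro genideal_subset) (auto simp: G_def)
  ultimately show "homogeneous_ideal I"
    unfolding homogeneous_ideal_def by (intro exI[of _ G]) (auto simp: G_def)
qed

subsection \<open>Initial forms and initial ideals\<close>

lemma initial_form_part:
  assumes "order_ge w \<mu> f" "part w \<mu> f \<noteq> 0"
  shows "initial_form w f = part w \<mu> f"
proof -
  from assms(2) obtain m0 where m0: "m0 \<in> keys f" "weight w m0 = \<mu>"
    unfolding keys_eq_empty[symmetric] keys_part by auto
  then have "{m \<in> keys f. \<forall>m'\<in>keys f. weight w m \<le> weight w m'} = {m \<in> keys f. weight w m = \<mu>}"
    using assms(1) by (force simp: order_ge_iff)
  then show ?thesis by (simp add: initial_form_def part_def)
qed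

text \<open>The zero polynomial has no lowest weight, but any \<open>\<mu>\<close> serves for it.\<close>

lemma initial_form_eq_part:
  obtains \<mu> where "order_ge w \<mu> f" "initial_form w f = part w \<mu> f"
proof (cases "f = 0")
  case True
  then show ?thesis using that[of 0] by (simp add: order_ge_iff part_zero initial_form_def)
next
  case False
  let ?\<mu> = "Min (weight w ` keys f)"
  have ne: "weight w ` keys f \<noteq> {}" using False by simp
  then have "?\<mu> \<in> weight w ` keys f" by (intro Min_in) auto
  then obtain m where m: "m \<in> keys f" "weight w m = ?\<mu>" by auto
  have ge: "order_ge w ?\<mu> f" by (auto simp: order_ge_iff)
  have "part w ?\<mu> f \<noteq> 0"
    unfolding keys_eq_empty[symmetric] keys_part using m by auto
  then show ?thesis using that[OF ge] initial_form_part[OF ge] by blast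
qed

lemma ideal_initial_ideal: "ideal (initial_ideal w I) cpoly_ring"
  unfolding initial_ideal_def by (rule ideal_genideal)

lemma part_in_initial_ideal:
  assumes "f \<in> I" "order_ge w \<mu> f"
  shows "part w \<mu> f \<in> initial_ideal w I"
proof (cases "part w \<mu> f = 0")
  case True
  then show ?thesis using ideal_zero[OF ideal_initial_ideal] by simp
next
  case False
  then show ?thesis
    using initial_form_part[OF assms(2) False] assms(1)
    unfolding initial_ideal_def by (metis in_genideal imageI)
qed

lemma initial_ideal_subset:
  assumes "ideal A cpoly_ring" "\<And>f \<mu>. f \<in> I \<Longrightarrow> order_ge w \<mu> f \<Longrightarrow> part w \<mu> f \<in> A"
  shows "initial_ideal w I \<subseteq> A"
  unfolding initial_ideal_def
proof (rule genideal_subset[OF assms(1)], clarify)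
  fix f assume "f \<in> I"
  then show "initial_form w f \<in> A" by (metis assms(2) initial_form_eq_part)
qed

text \<open>
  A term times an initial form is the lowest piece of the same term times the original element, so
  \<open>in\<^sub>w(I)\<close> is the additive span of lowest pieces of elements of \<open>I\<close>.
\<close>

lemma initial_ideal_induct [consumes 2, case_names zero add part]:
  assumes g: "g \<in> initial_ideal w I" and I: "ideal I cpoly_ring"
    and zero: "P 0" and add: "\<And>f g. P f \<Longrightarrow> P g \<Longrightarrow> P (f + g)"
    and part: "\<And>f \<mu>. f \<in> I \<Longrightarrow> order_ge w \<mu> f \<Longrightarrow> P (part w \<mu> f)"
  shows "P g"
  using g unfolding initial_ideal_def
proof (induction g rule: genideal_induct)
  case (mult m c s)
  then obtain f where f: "f \<in> I" and s: "s = initial_form w f" by auto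
  obtain \<mu> where \<mu>: "order_ge w \<mu> f" "initial_form w f = part w \<mu> f"
    by (rule initial_form_eq_part)
  have "order_ge w (weight w m + \<mu>) (single m c * f)"
    using \<mu>(1) by (auto simp: order_ge_def part_mult_single)
  then have "P (part w (weight w m + \<mu>) (single m c * f))"
    by (intro part ideal_mult[OF I] f)
  then show ?case by (simp add: s \<mu>(2) part_mult_single)
qed (auto intro: zero add)

section \<open>Points of affine varieties over the complex numbers\<close>

lemma countable_exponents: "countable (UNIV :: ('v::finite \<Rightarrow>\<^sub>0 nat) set)"
proof (rule countable_image_inj_on)
  show "countable (lookup ` (UNIV :: ('v \<Rightarrow>\<^sub>0 nat) set))"
    by (rule countable_subset[OF subset_UNIV]) simp
  show "inj (lookup :: ('v \<Rightarrow>\<^sub>0 nat) \<Rightarrow> _)"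
    by (rule injI) (simp add: poly_mapping_eqI)
qed

text \<open>
  The monomials are countable, hence so are the pairs of a finite set of monomials and a natural
  number, while the parameter \<open>c\<close> ranges over an uncountable set.
\<close>

lemma infinite_fibre_with_common_support:
  fixes g :: "complex \<Rightarrow> 'v::finite cpoly" and n :: "complex \<Rightarrow> nat"
  obtains S k where "finite S" "infinite {c. keys (g c) \<subseteq> S \<and> n c = k}"
proof -
  let ?F = "{S :: ('v \<Rightarrow>\<^sub>0 nat) set. finite S \<and> S \<subseteq> UNIV} \<times> (UNIV :: nat set)"
  let ?C = "\<lambda>(S, k). {c. keys (g c) \<subseteq> S \<and> n c = k}"
  have "countable ?F"
    using countable_Collect_finite_subset[OF countable_exponents] by (rule countable_SIGMA) simp
  moreover have "UNIV = \<Union> (?C ` ?F)"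
    by (auto intro!: exI[of _ "keys _"])
  ultimately have "\<exists>F\<in>?F. uncountable (?C F)"
    using uncountable_UNIV_complex countable_UN[of ?F ?C] by auto
  then show ?thesis using that by (auto dest!: uncountable_infinite)
qed

interpretation cpoly_vs: vector_space "\<lambda>(a::complex) f :: 'v cpoly. single 0 a * f"
proof
  fix a b :: complex and f :: "'v cpoly"
  show "single 0 a * (single 0 b * f) = single 0 (a * b) * f"
    by (simp add: mult_single flip: mult.assoc)
qed (simp_all add: ring_distribs single_add)

lemma linear_relation_of_bounded_support:
  fixes g :: "complex \<Rightarrow> 'v cpoly"
  assumes S: "finite S" and C: "infinite C" and g: "inj_on g C" "\<And>c. c \<in> C \<Longrightarrow> keys (g c) \<subseteq> S"
  obtains D u d where "finite D" "D \<subseteq> C" "(\<Sum>c\<in>D. single 0 (u c) * g c) = 0" "d \<in> D" "u d \<noteq> 0"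
proof -
  let ?T = "(\<lambda>m. single m 1) ` S :: 'v cpoly set"
  have "g c \<in> cpoly_vs.span ?T" if "c \<in> C" for c
  proof -
    have "single m (lookup (g c) m) \<in> cpoly_vs.span ?T" if "m \<in> S" for m
      using cpoly_vs.span_scale[OF cpoly_vs.span_base, of "single m 1" ?T "lookup (g c) m"] that
      by (simp add: mult_single)
    then have "(\<Sum>m\<in>keys (g c). single m (lookup (g c) m)) \<in> cpoly_vs.span ?T"
      using g(2)[OF that] by (intro cpoly_vs.span_sum) auto
    then show ?thesis using cpoly_sum[of "g c"] by simp
  qed
  then have "g ` C \<subseteq> cpoly_vs.span ?T" by auto
  moreover have "infinite (g ` C)" using C g(1) finite_imageD by blast
  ultimately have "cpoly_vs.dependent (g ` C)"
    using cpoly_vs.independent_span_bound[of ?T "g ` C"] S by blast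
  then obtain T u v where T: "finite T" "T \<subseteq> g ` C" "(\<Sum>v\<in>T. single 0 (u v) * v) = 0" "v \<in> T" "u v \<noteq> 0"
    unfolding cpoly_vs.dependent_explicit by blast
  from T(1,2) obtain D where D: "D \<subseteq> C" "finite D" "T = g ` D"
    using finite_subset_image by metis
  have "inj_on g D" using g(1) D(1) inj_on_subset by blast
  then have "(\<Sum>c\<in>D. single 0 (u (g c)) * g c) = 0"
    using T(3) D(3) by (simp add: sum.reindex)
  moreover obtain d where "d \<in> D" "v = g d" using T(4) D(3) by auto
  ultimately show ?thesis using that[of D "u \<circ> g" d] D T(5) by auto
qed

definition univariate_at :: "'v cpoly \<Rightarrow> complex poly \<Rightarrow> 'v cpoly"
  where "univariate_at x q = poly (map_poly (single 0) q) x"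

lemma univariate_at_pCons: "univariate_at x (pCons a q) = single 0 a + x * univariate_at x q"
  by (simp add: univariate_at_def map_poly_pCons)

lemma univariate_at_zero: "univariate_at x 0 = 0"
  by (simp add: univariate_at_def)

lemma univariate_at_add: "univariate_at x (p + q) = univariate_at x p + univariate_at x q"
proof -
  have "map_poly (single 0) (p + q) = map_poly (single 0) p + (map_poly (single 0) q :: 'a cpoly poly)"
    by (rule poly_eqI) (simp add: coeff_map_poly single_add)
  then show ?thesis by (simp add: univariate_at_def)
qed

lemma univariate_at_smult: "univariate_at x (smult a p) = single 0 a * univariate_at x p"
  by (simp add: univariate_at_def map_poly_smult mult_single)

lemma univariate_at_mult: "univariate_at x (p * q) = univariate_at x p * univariate_at x q"
  by (induction p)
    (simp_all add: univariate_at_zero univariate_at_pCons univariate_at_add univariate_at_smult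
      distrib_right mult.assoc)

lemma univariate_at_const: "univariate_at x [:a:] = single 0 a"
  by (simp add: univariate_at_pCons univariate_at_zero)

lemma univariate_at_linear: "univariate_at x [:- c, 1:] = x - single 0 c"
  by (simp add: univariate_at_pCons univariate_at_zero single_uminus)

lemma univariate_at_one: "univariate_at x 1 = 1"
  using univariate_at_const[of x 1] by (simp add: one_pCons)

lemma univariate_at_sum: "univariate_at x (sum f A) = (\<Sum>a\<in>A. univariate_at x (f a))"
  and univariate_at_prod: "univariate_at x (prod f A) = (\<Prod>a\<in>A. univariate_at x (f a))"
  by (induction A rule: infinite_finite_induct)
    (simp_all add: univariate_at_zero univariate_at_one univariate_at_add univariate_at_mult)

text \<open>
  Here \<open>\<complex>\<close> has to be algebraically closed: \<open>q\<close> splits into linear factors, none of whose values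
  at \<open>x\<close> lies in the prime ideal.
\<close>

lemma univariate_at_notin_prime:
  assumes M: "primeideal M cpoly_ring" and x: "\<And>c. x - single 0 c \<notin> M" and q: "q \<noteq> 0"
  shows "univariate_at x q \<notin> M"
  using q
proof (induction "degree q" arbitrary: q)
  case 0
  then obtain a where a: "q = [:a:]" "a \<noteq> 0" by (metis degree_eq_zeroE pCons_0_0)
  have "single 0 (inverse a) * single 0 a \<notin> M"
    using M a(2) by (simp add: mult_single primeideal_class_iff)
  then show ?case
    using M ideal_mult unfolding primeideal_class_iff a(1) univariate_at_const by blast
next
  case (Suc n)
  then have "\<not> constant (poly q)" by (simp add: constant_degree)
  then obtain z where "poly q z = 0" using fundamental_theorem_of_algebra by blast
  then obtain r where r: "q = [:- z, 1:] * r" by (auto simp: poly_eq_0_iff_dvd elim: dvdE)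
  then have "r \<noteq> 0" using Suc.prems by auto
  then have "degree q = Suc (degree r)" unfolding r by (subst degree_mult_eq) auto
  then have "univariate_at x r \<notin> M" using Suc.hyps \<open>r \<noteq> 0\<close> by simp
  then show ?case
    using M x unfolding r univariate_at_mult univariate_at_linear primeideal_class_iff by blast
qed

text \<open>
  Modulo \<open>M\<close> every nonzero element divides a power of \<open>h\<close>; equivalently, the localisation of
  \<open>\<complex>[x] / M\<close> at \<open>h\<close> is a field. The last conclusion expresses this without localising.
\<close>

lemma exists_ideal_maximal_avoiding_powers:
  fixes P :: "'v cpoly set"
  assumes P: "primeideal P cpoly_ring" and h: "h \<notin> P"
  obtains M where "primeideal M cpoly_ring" "P \<subseteq> M" "h \<notin> M"
    and "\<And>f. f \<notin> M \<Longrightarrow> \<exists>n g. h ^ n - g * f \<in> M"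
proof -
  define A where "A = {M. ideal M (cpoly_ring :: 'v cpoly ring) \<and> P \<subseteq> M \<and> (\<forall>n. h ^ n \<notin> M)}"
  have "h ^ n \<notin> P" for n
    using P h by (induction n) (auto simp: primeideal_class_iff)
  then have "P \<in> A" using P by (auto simp: A_def primeideal_class_iff)
  moreover have "\<Union>C \<in> A" if "C \<noteq> {}" "subset.chain A C" for C
  proof -
    have C: "C \<subseteq> A" and lin: "\<And>X Y. X \<in> C \<Longrightarrow> Y \<in> C \<Longrightarrow> X \<subseteq> Y \<or> Y \<subseteq> X"
      using that(2) by (auto simp: subset_chain_def)
    have id: "ideal X (cpoly_ring :: 'v cpoly ring)" if "X \<in> C" for X
      using C that by (auto simp: A_def)
    have "ideal (\<Union>C) (cpoly_ring :: 'v cpoly ring)"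
      unfolding ideal_class_iff
    proof (intro conjI ballI allI)
      show "0 \<in> \<Union>C" using \<open>C \<noteq> {}\<close> id ideal_zero by blast
      fix a assume "a \<in> \<Union>C"
      then obtain X where X: "X \<in> C" "a \<in> X" by auto
      show "r * a \<in> \<Union>C" for r using X id ideal_mult by blast
      fix b assume "b \<in> \<Union>C"
      then obtain Y where Y: "Y \<in> C" "b \<in> Y" by auto
      show "a + b \<in> \<Union>C"
        using lin[OF X(1) Y(1)] X Y id ideal_add by (metis UnionI subsetD)
    qed
    then show ?thesis using C \<open>C \<noteq> {}\<close> by (fastforce simp: A_def)
  qed
  ultimately obtain M where M: "M \<in> A" and max: "\<And>X. X \<in> A \<Longrightarrow> M \<subseteq> X \<Longrightarrow> X = M"
    using subset_Zorn_nonempty[of A] by blast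
  then have id: "ideal M cpoly_ring" and PM: "P \<subseteq> M" and hM: "\<And>n. h ^ n \<notin> M"
    by (auto simp: A_def)
  have inv: "\<exists>n g. h ^ n - g * f \<in> M" if "f \<notin> M" for f
  proof (rule ccontr)
    assume neg: "\<not> ?thesis"
    define X where "X = {a + g * f |a g. a \<in> M}"
    have "ideal X cpoly_ring"
      unfolding ideal_class_iff
    proof (intro conjI ballI allI)
      show "0 \<in> X" unfolding X_def using ideal_zero[OF id] by (auto intro!: exI[of _ 0])
      fix x assume "x \<in> X"
      then obtain a g where x: "x = a + g * f" "a \<in> M" by (auto simp: X_def)
      show "r * x \<in> X" for r
        unfolding X_def x(1)
        using ideal_mult[OF id x(2), of r] by (force simp: algebra_simps)
      fix y assume "y \<in> X"
      then obtain b k where y: "y = b + k * f" "b \<in> M" by (auto simp: X_def)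
      show "x + y \<in> X"
        unfolding X_def x(1) y(1)
        using ideal_add[OF id x(2) y(2)] by (intro CollectI exI[of _ "a + b"] exI[of _ "g + k"]) (simp add: algebra_simps)
    qed
    moreover have "M \<subseteq> X" unfolding X_def by (force intro: exI[of _ 0])
    moreover have "h ^ n \<notin> X" for n
    proof
      assume "h ^ n \<in> X"
      then obtain a g where "h ^ n = a + g * f" "a \<in> M" by (auto simp: X_def)
      then have "h ^ n - g * f \<in> M" by simp
      then show False using neg by blast
    qed
    ultimately have "X \<in> A" using PM unfolding A_def by blast
    then have "X = M" using max \<open>M \<subseteq> X\<close> by blast
    moreover have "f = 0 + 1 * f" by simp
    then have "f \<in> X" unfolding X_def using ideal_zero[OF id] by blast
    ultimately show False using that by simp
  qed
  have "primeideal M cpoly_ring"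
    unfolding primeideal_class_iff
  proof (intro conjI allI impI id)
    show "1 \<notin> M" using hM[of 0] by simp
    fix a b assume ab: "a * b \<in> M"
    show "a \<in> M \<or> b \<in> M"
    proof (rule ccontr)
      assume "\<not> ?thesis"
      then obtain n g k g' where g: "h ^ n - g * a \<in> M" "h ^ k - g' * b \<in> M"
        using inv by blast
      have "h ^ (n + k) = (h ^ n - g * a) * h ^ k + g * a * (h ^ k - g' * b) + g * g' * (a * b)"
        by (simp add: algebra_simps power_add)
      also have "\<dots> \<in> M"
        by (intro ideal_add[OF id] ideal_mult_right[OF id g(1)] ideal_mult[OF id g(2)] ideal_mult[OF id ab])
      finally show False using hM by blast
    qed
  qed
  then show ?thesis using that[OF _ PM _ inv] hM[of 1] by simp
qed

text \<open>
  If no \<open>x - c\<close> were in \<open>M\<close>, every \<open>x - c\<close> would divide a power \<open>h\<^sup>n\<close> modulo \<open>M\<close>, with a quotient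
  \<open>g\<^sub>c\<close> that plays the role of \<open>h\<^sup>n / (x - c)\<close>. Infinitely many \<open>g\<^sub>c\<close> share the exponent \<open>n\<close>
  and lie in one finite-dimensional space of polynomials, so they satisfy a linear relation.
  Clearing denominators turns it into a nonzero univariate polynomial whose value at \<open>x\<close> lies in \<open>M\<close>.
\<close>

lemma coordinate_constant_modulo_maximal:
  fixes M :: "'v::finite cpoly set"
  assumes M: "primeideal M cpoly_ring" and h: "h \<notin> M"
    and inv: "\<And>f. f \<notin> M \<Longrightarrow> \<exists>n g. h ^ n - g * f \<in> M"
  shows "\<exists>c. x - single 0 c \<in> M"
proof (rule ccontr)
  assume "\<nexists>c. x - single 0 c \<in> M"
  then have x: "\<And>c. x - single 0 c \<notin> M" by blast
  have id: "ideal M cpoly_ring" and prime: "\<And>a b. a * b \<in> M \<Longrightarrow> a \<in> M \<or> b \<in> M" and one: "1 \<notin> M"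
    using M by (auto simp: primeideal_class_iff)
  have hn: "h ^ n \<notin> M" for n
    using h one prime by (induction n) auto
  have "\<forall>c. \<exists>n g. h ^ n - g * (x - single 0 c) \<in> M"
    using inv[OF x] by blast
  then obtain n where "\<forall>c. \<exists>g. h ^ n c - g * (x - single 0 c) \<in> M"
    by (rule choice[THEN exE])
  then obtain g where "\<forall>c. h ^ n c - g c * (x - single 0 c) \<in> M"
    by (rule choice[THEN exE])
  then have g: "h ^ n c - g c * (x - single 0 c) \<in> M" for c
    by blast
  obtain S k where S: "finite S" and C: "infinite {c. keys (g c) \<subseteq> S \<and> n c = k}"
    by (rule infinite_fibre_with_common_support)
  let ?C = "{c. keys (g c) \<subseteq> S \<and> n c = k}"
  have "inj_on g ?C"
  proof (rule inj_onI, rule ccontr)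
    fix c c' assume c: "c \<in> ?C" "c' \<in> ?C" "g c = g c'" and ne: "c \<noteq> c'"
    have "(h ^ k - g c * (x - single 0 c)) - (h ^ k - g c' * (x - single 0 c')) \<in> M"
      using ideal_diff[OF id g[of c] g[of c']] c by simp
    then have "single 0 (c - c') * g c \<in> M"
      unfolding c(3) by (simp add: algebra_simps single_diff)
    then have "single 0 (inverse (c - c')) * (single 0 (c - c') * g c) \<in> M"
      by (rule ideal_mult[OF id])
    then have "g c \<in> M" using ne by (simp add: mult_single flip: mult.assoc)
    then have "h ^ k \<in> M"
      using ideal_cong[OF id g[of c]] ideal_mult_right[OF id] c by simp
    then show False using hn by simp
  qed
  then obtain D u d where D: "finite D" "D \<subseteq> ?C" "(\<Sum>c\<in>D. single 0 (u c) * g c) = 0"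
    and d: "d \<in> D" "u d \<noteq> 0"
    by (rule linear_relation_of_bounded_support[OF S C]) auto
  \<comment> \<open>the relation \<open>\<Sum> u\<^sub>c / (x - c) = 0\<close>, multiplied by all \<open>x - c\<close>\<close>
  define q where "q = (\<Sum>c\<in>D. smult (u c) (\<Prod>c'\<in>D - {c}. [:- c', 1:]))"
  \<comment> \<open>at the node \<open>d\<close> only the summand that lacks the factor \<open>x - d\<close> survives\<close>
  have "poly q d = (\<Sum>c\<in>D. if c = d then u d * (\<Prod>c'\<in>D - {d}. d - c') else 0)"
    unfolding q_def poly_sum
    by (intro sum.cong refl) (auto simp: poly_prod intro!: prod_zero D(1) d(1))
  also have "\<dots> = u d * (\<Prod>c'\<in>D - {d}. d - c')"
    using D(1) d(1) by simp
  finally have "q \<noteq> 0" using d D(1) by auto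
  then have "univariate_at x q \<notin> M"
    by (rule univariate_at_notin_prime[OF M x])
  moreover have "h ^ k * univariate_at x q \<in> M"
  proof -
    let ?R = "\<lambda>c. \<Prod>c'\<in>D - {c}. x - single 0 c'"
    have "h ^ k * univariate_at x q = (\<Sum>c\<in>D. h ^ k * (single 0 (u c) * ?R c))"
      by (simp add: q_def univariate_at_sum univariate_at_smult univariate_at_prod
          univariate_at_linear sum_distrib_left)
    also have "\<dots> = (\<Sum>c\<in>D. single 0 (u c) * ?R c * (h ^ k - g c * (x - single 0 c))
        + single 0 (u c) * g c * ((x - single 0 c) * ?R c))"
      by (intro sum.cong refl) (simp add: algebra_simps)
    also have "\<dots> = (\<Sum>c\<in>D. single 0 (u c) * ?R c * (h ^ k - g c * (x - single 0 c))
        + single 0 (u c) * g c * (\<Prod>c'\<in>D. x - single 0 c'))"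
      using D(1) by (intro sum.cong refl) (simp add: prod.remove)
    also have "\<dots> = (\<Sum>c\<in>D. single 0 (u c) * ?R c * (h ^ k - g c * (x - single 0 c)))"
      using D(3) by (simp add: sum.distrib flip: sum_distrib_right)
    also have "\<dots> \<in> M"
      using g D(2) by (intro ideal_sum[OF id] ideal_mult[OF id]) auto
    finally show ?thesis .
  qed
  ultimately show False using prime hn by blast
qed

text \<open>
  The Nullstellensatz in the form used below: modulo the ideal \<open>M\<close> of the preceding lemmas all
  variables are constants, and these constants are the coordinates of the point.
\<close>

lemma exists_point_avoiding:
  fixes P :: "'v::finite cpoly set"
  assumes P: "primeideal P cpoly_ring" and h: "h \<notin> P"
  obtains p where "\<And>f. f \<in> P \<Longrightarrow> poly_at p f = 0" "poly_at p h \<noteq> 0"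
proof -
  obtain M where M: "primeideal M cpoly_ring" "P \<subseteq> M" "h \<notin> M"
    and inv: "\<And>f. f \<notin> M \<Longrightarrow> \<exists>n g. h ^ n - g * f \<in> M"
    using exists_ideal_maximal_avoiding_powers[OF P h] by metis
  have id: "ideal M cpoly_ring" and one: "1 \<notin> M"
    using M by (auto simp: primeideal_class_iff)
  have "\<forall>v. \<exists>c. var_poly v - single 0 c \<in> M"
    using coordinate_constant_modulo_maximal[OF M(1,3) inv] by blast
  then obtain p where p: "\<And>v. var_poly v - single 0 (p v) \<in> M" by metis
  have eval: "f - single 0 (poly_at p f) \<in> M" for f
  proof (induction f rule: cpoly_ring_induct)
    case (add f g)
    have "f + g - single 0 (poly_at p (f + g)) =
        (f - single 0 (poly_at p f)) + (g - single 0 (poly_at p g))"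
      by (simp add: poly_at_simps single_add)
    then show ?case using ideal_add[OF id add] by metis
  next
    case (mult f g)
    have "f * g - single 0 (poly_at p (f * g)) =
        g * (f - single 0 (poly_at p f)) + single 0 (poly_at p f) * (g - single 0 (poly_at p g))"
      by (simp add: poly_at_simps algebra_simps mult_single)
    then show ?case using ideal_add[OF id ideal_mult[OF id mult(1)] ideal_mult[OF id mult(2)]] by metis
  qed (simp_all add: poly_at_simps p ideal_zero[OF id])
  show ?thesis
  proof
    fix f assume "f \<in> P"
    then have "single 0 (poly_at p f) \<in> M"
      using M(2) ideal_cong[OF id eval[of f]] by blast
    then have "single 0 (inverse (poly_at p f)) * single 0 (poly_at p f) \<in> M"
      by (rule ideal_mult[OF id])
    then show "poly_at p f = 0"
      using one by (cases "poly_at p f = 0") (simp_all add: mult_single)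
  next
    show "poly_at p h \<noteq> 0"
      using M(3) eval[of h] by auto
  qed
qed

section \<open>Sums of ideals in disjoint sets of variables\<close>

abbreviation left_incl :: "'n cpoly \<Rightarrow> ('n + 'm) cpoly"
  where "left_incl \<equiv> poly_subst (\<lambda>i. var_poly (Inl i))"

abbreviation right_incl :: "'m cpoly \<Rightarrow> ('n + 'm) cpoly"
  where "right_incl \<equiv> poly_subst (\<lambda>j. var_poly (Inr j))"

lemma sum_ideal_genideal:
  "sum_ideal I J = genideal cpoly_ring (left_incl ` I \<union> right_incl ` J)"
proof -
  let ?A = "left_incl ` I" and ?B = "right_incl ` J"
  have "sum_ideal I J = genideal cpoly_ring (genideal cpoly_ring ?A \<union> genideal cpoly_ring ?B)"
    unfolding sum_ideal_def
    by (rule ring.union_genideal[OF cring.axioms(1)[OF cring_class], symmetric])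
      (rule ideal_genideal)+
  also have "\<dots> = genideal cpoly_ring (?A \<union> ?B)"
  proof
    show "genideal cpoly_ring (genideal cpoly_ring ?A \<union> genideal cpoly_ring ?B)
        \<subseteq> genideal cpoly_ring (?A \<union> ?B)"
      by (intro genideal_subset[OF ideal_genideal] Un_least genideal_mono Un_upper1 Un_upper2)
    show "genideal cpoly_ring (?A \<union> ?B)
        \<subseteq> genideal cpoly_ring (genideal cpoly_ring ?A \<union> genideal cpoly_ring ?B)"
      by (intro genideal_mono Un_mono subset_genideal)
  qed
  finally show ?thesis .
qed

lemma ideal_sum_ideal: "ideal (sum_ideal I J) cpoly_ring"
  unfolding sum_ideal_genideal by (rule ideal_genideal)

lemma left_incl_in_sum_ideal: "f \<in> I \<Longrightarrow> left_incl f \<in> sum_ideal I J"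
  and right_incl_in_sum_ideal: "g \<in> J \<Longrightarrow> right_incl g \<in> sum_ideal I J"
  unfolding sum_ideal_genideal by (rule in_genideal, blast)+

lemma sum_ideal_subset:
  assumes "ideal A cpoly_ring" "\<And>f. f \<in> I \<Longrightarrow> left_incl f \<in> A" "\<And>g. g \<in> J \<Longrightarrow> right_incl g \<in> A"
  shows "sum_ideal I J \<subseteq> A"
  unfolding sum_ideal_genideal by (rule genideal_subset[OF assms(1)]) (use assms in auto)

definition partial_eval :: "('n \<Rightarrow> complex) \<Rightarrow> ('n + 'm) cpoly \<Rightarrow> 'm cpoly"
  where "partial_eval p = poly_subst (case_sum (\<lambda>i. single 0 (p i)) var_poly)"

lemma partial_eval_left: "partial_eval p (left_incl f) = single 0 (poly_at p f)"
  by (induction f rule: cpoly_ring_induct)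
    (simp_all add: partial_eval_def poly_subst_simps poly_at_simps single_add mult_single)

lemma partial_eval_right: "partial_eval p (right_incl g) = g"
  by (induction g rule: cpoly_ring_induct)
    (simp_all add: partial_eval_def poly_subst_simps)

lemma ideal_poly_subst_vimage:
  assumes "ideal A cpoly_ring"
  shows "ideal (poly_subst h -` A) cpoly_ring"
  using assms by (simp add: ideal_class_iff poly_subst_simps)

lemma primeideal_poly_subst_vimage:
  assumes "primeideal A cpoly_ring"
  shows "primeideal (poly_subst h -` A) cpoly_ring"
  using assms ideal_poly_subst_vimage[of A h] by (simp add: primeideal_class_iff poly_subst_simps)

lemma ideal_const:
  fixes Q :: "'v cpoly set"
  assumes "primeideal Q cpoly_ring" "single 0 c \<in> Q"
  shows "c = 0"
proof (rule ccontr)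
  assume "c \<noteq> 0"
  have "single 0 (inverse c) * single 0 c \<in> Q"
    using assms by (intro ideal_mult) (auto simp: primeideal_class_iff)
  then show False using assms(1) \<open>c \<noteq> 0\<close> by (simp add: mult_single primeideal_class_iff)
qed

lemma partial_eval_sum_ideal:
  assumes Q: "ideal Q cpoly_ring" and p: "\<And>f. f \<in> P \<Longrightarrow> poly_at p f = 0"
    and f: "f \<in> sum_ideal P Q"
  shows "partial_eval p f \<in> Q"
proof -
  have "sum_ideal P Q \<subseteq> partial_eval p -` Q"
  proof (rule sum_ideal_subset)
    show "ideal (partial_eval p -` Q) cpoly_ring"
      unfolding partial_eval_def by (rule ideal_poly_subst_vimage[OF Q])
  qed (simp_all add: partial_eval_left partial_eval_right p ideal_zero[OF Q])
  then show ?thesis using f by blast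
qed

definition split_sum :: "'i set \<Rightarrow> ('i \<Rightarrow> 'n cpoly) \<Rightarrow> ('i \<Rightarrow> 'm cpoly) \<Rightarrow> ('n + 'm) cpoly"
  where "split_sum A a b = (\<Sum>m\<in>A. left_incl (a m) * right_incl (b m))"

definition inl_exp :: "('n \<Rightarrow>\<^sub>0 nat) \<Rightarrow> ('n + 'm \<Rightarrow>\<^sub>0 nat)"
  where "inl_exp = exp_map (\<lambda>i. single (Inl i) 1)"

definition inr_exp :: "('m \<Rightarrow>\<^sub>0 nat) \<Rightarrow> ('n + 'm \<Rightarrow>\<^sub>0 nat)"
  where "inr_exp = exp_map (\<lambda>j. single (Inr j) 1)"

lemma left_incl_single: "left_incl (single a c) = single (inl_exp a) c"
  and right_incl_single: "right_incl (single b c) = single (inr_exp b) c"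
  unfolding var_poly_def monom_poly_def inl_exp_def inr_exp_def by (rule poly_subst_single)+

lemma inl_exp_zero: "inl_exp 0 = 0" and inr_exp_zero: "inr_exp 0 = 0"
  by (simp_all add: inl_exp_def inr_exp_def exp_map_zero)

definition left_exp :: "('n + 'm \<Rightarrow>\<^sub>0 nat) \<Rightarrow> ('n \<Rightarrow>\<^sub>0 nat)"
  where "left_exp = exp_map (case_sum (\<lambda>i. single i 1) (\<lambda>_. 0))"

definition right_exp :: "('n + 'm \<Rightarrow>\<^sub>0 nat) \<Rightarrow> ('m \<Rightarrow>\<^sub>0 nat)"
  where "right_exp = exp_map (case_sum (\<lambda>_. 0) (\<lambda>j. single j 1))"

lemma exponent_split: "inl_exp (left_exp m) + inr_exp (right_exp m) = m"
proof (induction m rule: exponent_induct)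
  case (single v)
  show ?case
    by (cases v) (simp_all add: inl_exp_def inr_exp_def left_exp_def right_exp_def
        exp_map_zero exp_map_single del: One_nat_def)
next
  case (add a b)
  have "inl_exp (left_exp (a + b)) + inr_exp (right_exp (a + b)) =
      (inl_exp (left_exp a) + inr_exp (right_exp a)) + (inl_exp (left_exp b) + inr_exp (right_exp b))"
    by (simp add: inl_exp_def inr_exp_def left_exp_def right_exp_def exp_map_add ac_simps)
  then show ?case by (simp add: add)
qed (simp add: inl_exp_def inr_exp_def left_exp_def right_exp_def exp_map_zero)

lemma exp_map_id: "exp_map (\<lambda>v. single v 1) m = m"
  by (induction m rule: exponent_induct)
    (simp_all add: exp_map_zero exp_map_single exp_map_add del: One_nat_def)

lemma exp_map_0: "exp_map (\<lambda>v. 0) m = 0"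
  by (simp add: exp_map_def)

lemma left_exp_add: "left_exp (m + inl_exp a) = left_exp m + a"
    "left_exp (m + inr_exp b) = left_exp m"
  and right_exp_add: "right_exp (m + inl_exp a) = right_exp m"
    "right_exp (m + inr_exp b) = right_exp m + b"
  by (simp_all add: left_exp_def right_exp_def inl_exp_def inr_exp_def exp_map_add
      exp_map_exp_map exp_map_single exp_map_id exp_map_0 del: One_nat_def)

lemma exists_split_sum:
  fixes f :: "('n + 'm) cpoly"
  obtains a b where "f = split_sum (keys f) a b"
proof -
  have "single m c = left_incl (single (left_exp m) c) * right_incl (single (right_exp m) 1)"
    for m :: "'n + 'm \<Rightarrow>\<^sub>0 nat" and c :: complex
    by (simp add: left_incl_single right_incl_single mult_single exponent_split)
  then have "f = split_sum (keys f) (\<lambda>m. single (left_exp m) (lookup f m)) (\<lambda>m. single (right_exp m) 1)"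
    unfolding split_sum_def using cpoly_sum[of f] by simp
  then show ?thesis by (rule that)
qed

text \<open>
  Represent \<open>f\<close> modulo \<open>P + Q\<close> as \<open>\<Sum> a\<^sub>m(x) b\<^sub>m(y)\<close> with as few summands as possible. Then the \<open>b\<^sub>m\<close>
  are linearly independent modulo \<open>Q\<close> and no \<open>a\<^sub>m\<close> lies in \<open>P\<close>, since otherwise a summand could be
  saved. At a point of \<open>V(P)\<close> where one coefficient \<open>a\<^sub>m\<close> does not vanish, independence gives
  \<open>f(p, y) \<notin> Q\<close>.
\<close>

lemma detecting_polynomial:
  fixes P :: "'n cpoly set" and Q :: "'m cpoly set"
  assumes Q: "ideal Q cpoly_ring" and f: "f \<notin> sum_ideal P Q"
  obtains a where "a \<notin> P"
    "\<And>p. (\<And>g. g \<in> P \<Longrightarrow> poly_at p g = 0) \<Longrightarrow> poly_at p a \<noteq> 0 \<Longrightarrow> partial_eval p f \<notin> Q"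
proof -
  let ?S = "sum_ideal P Q"
  note S = ideal_sum_ideal[of P Q]
  define R where "R A \<longleftrightarrow> finite A \<and> (\<exists>a b. f - split_sum A a b \<in> ?S)" for A :: "('n + 'm \<Rightarrow>\<^sub>0 nat) set"
  obtain a0 b0 where "f = split_sum (keys f) a0 b0" by (rule exists_split_sum)
  then have "f - split_sum (keys f) a0 b0 \<in> ?S" using ideal_zero[OF S] by simp
  then have "R (keys f)" unfolding R_def by auto
  then obtain A where A: "R A" and min: "\<And>B. R B \<Longrightarrow> card A \<le> card B"
    using ex_has_least_nat[of R "keys f" card] by blast
  from A have fin: "finite A" by (simp add: R_def)
  from A obtain a b where ab: "f - split_sum A a b \<in> ?S" by (auto simp: R_def)
  have drop: False if k: "k \<in> A" and "split_sum A a b - split_sum (A - {k}) a' b' \<in> ?S" for k a' b'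
  proof -
    have "f - split_sum (A - {k}) a' b' \<in> ?S"
      using ideal_add[OF S ab that(2)] by simp
    then have "R (A - {k})" using fin by (auto simp: R_def)
    then show False using min card_Diff1_less[OF fin k] by fastforce
  qed
  have indep: "c k = 0" if c: "(\<Sum>m\<in>A. single 0 (c m) * b m) \<in> Q" and k: "k \<in> A" for c k
  proof (rule ccontr)
    assume "c k \<noteq> 0"
    \<comment> \<open>solve the relation for \<open>b k\<close> and substitute\<close>
    define d where "d m = c m / c k" for m
    have dk: "d k = 1" using \<open>c k \<noteq> 0\<close> by (simp add: d_def)
    have scal: "single 0 (d m) = single 0 (inverse (c k)) * (single 0 (c m) :: 'm cpoly)" for m
      by (simp add: mult_single d_def divide_inverse mult.commute)
    define a' where "a' m = a m - single 0 (d m) * a k" for m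
    have "split_sum A a b - split_sum A a' b =
        (\<Sum>m\<in>A. left_incl (a k) * right_incl (single 0 (d m) * b m))"
      unfolding split_sum_def a'_def sum_subtractf[symmetric]
      by (intro sum.cong refl) (simp add: poly_subst_simps algebra_simps)
    also have "\<dots> = left_incl (a k) * right_incl (\<Sum>m\<in>A. single 0 (d m) * b m)"
      by (simp add: poly_subst_simps sum_distrib_left)
    also have "(\<Sum>m\<in>A. single 0 (d m) * b m) = single 0 (inverse (c k)) * (\<Sum>m\<in>A. single 0 (c m) * b m)"
      by (simp add: sum_distrib_left scal mult.assoc)
    also have "left_incl (a k) * right_incl \<dots> \<in> ?S"
      by (intro ideal_mult[OF S] right_incl_in_sum_ideal ideal_mult[OF Q] c)
    also have "split_sum A a' b = split_sum (A - {k}) a' b"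
      unfolding split_sum_def
      by (subst sum.remove[OF fin k]) (simp add: a'_def dk poly_subst_simps)
    finally show False by (rule drop[OF k])
  qed
  have "A \<noteq> {}" using ab f by (auto simp: split_sum_def)
  then obtain m0 where m0: "m0 \<in> A" by blast
  show ?thesis
  proof
    show "a m0 \<notin> P"
    proof
      assume "a m0 \<in> P"
      then have "split_sum A a b - split_sum (A - {m0}) a b \<in> ?S"
        unfolding split_sum_def
        by (subst sum.remove[OF fin m0]) (simp add: ideal_mult_right[OF S] left_incl_in_sum_ideal)
      then show False by (rule drop[OF m0])
    qed
  next
    fix p assume p: "\<And>g. g \<in> P \<Longrightarrow> poly_at p g = 0" "poly_at p (a m0) \<noteq> 0"
    have "partial_eval p (f - split_sum A a b) \<in> Q"
      by (rule partial_eval_sum_ideal[OF Q p(1) ab])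
    then have "partial_eval p f - (\<Sum>m\<in>A. partial_eval p (left_incl (a m)) * partial_eval p (right_incl (b m))) \<in> Q"
      unfolding partial_eval_def split_sum_def by (simp add: poly_subst_simps)
    then have "partial_eval p f - (\<Sum>m\<in>A. single 0 (poly_at p (a m)) * b m) \<in> Q"
      by (simp add: partial_eval_left partial_eval_right)
    then show "partial_eval p f \<notin> Q"
      using ideal_cong[OF Q, of "partial_eval p f"] indep[of "\<lambda>m. poly_at p (a m)", OF _ m0] p(2)
      by blast
  qed
qed

lemma tensor_notin_sum_ideal:
  fixes P :: "'n::finite cpoly set" and Q :: "'m cpoly set"
  assumes P: "primeideal P cpoly_ring" and Q: "primeideal Q cpoly_ring"
    and "f \<notin> P" "g \<notin> Q"
  shows "left_incl f * right_incl g \<notin> sum_ideal P Q"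
proof
  assume *: "left_incl f * right_incl g \<in> sum_ideal P Q"
  obtain p where p: "\<And>f. f \<in> P \<Longrightarrow> poly_at p f = 0" "poly_at p f \<noteq> 0"
    using exists_point_avoiding[OF P \<open>f \<notin> P\<close>] by blast
  have "partial_eval p (left_incl f * right_incl g) \<in> Q"
    using Q by (intro partial_eval_sum_ideal[OF _ p(1) *]) (simp add: primeideal_class_iff)
  then have "partial_eval p (left_incl f) * partial_eval p (right_incl g) \<in> Q"
    by (simp add: partial_eval_def poly_subst_simps)
  then show False
    using Q ideal_const[OF Q, of "poly_at p f"] p(2) \<open>g \<notin> Q\<close>
    by (auto simp: partial_eval_left partial_eval_right primeideal_class_iff)
qed

text \<open>
  Let \<open>a\<close> and \<open>b\<close> detect \<open>f\<close> and \<open>g\<close>. Since \<open>P\<close> is prime, \<open>a b\<close> does not vanish identically on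
  \<open>V(P)\<close>, and one point where it is nonzero detects both \<open>f\<close> and \<open>g\<close> at once.
\<close>

theorem primeideal_sum_ideal:
  fixes P :: "'n::finite cpoly set" and Q :: "'m cpoly set"
  assumes P: "primeideal P cpoly_ring" and Q: "primeideal Q cpoly_ring"
  shows "primeideal (sum_ideal P Q) cpoly_ring"
  unfolding primeideal_class_iff
proof (intro conjI allI impI ideal_sum_ideal)
  have "left_incl 1 * right_incl 1 \<notin> sum_ideal P Q"
    using P Q by (intro tensor_notin_sum_ideal) (auto simp: primeideal_class_iff)
  then show "1 \<notin> sum_ideal P Q" by (simp add: poly_subst_simps)
next
  fix f g assume fg: "f * g \<in> sum_ideal P Q"
  have idQ: "ideal Q cpoly_ring" using Q by (simp add: primeideal_class_iff)
  show "f \<in> sum_ideal P Q \<or> g \<in> sum_ideal P Q"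
  proof (rule ccontr)
    assume "\<not> ?thesis"
    then have f: "f \<notin> sum_ideal P Q" and g: "g \<notin> sum_ideal P Q" by auto
    obtain a where a: "a \<notin> P" "\<And>p. (\<And>g. g \<in> P \<Longrightarrow> poly_at p g = 0) \<Longrightarrow> poly_at p a \<noteq> 0 \<Longrightarrow>
        partial_eval p f \<notin> Q"
      using detecting_polynomial[OF idQ f] by blast
    obtain b where b: "b \<notin> P" "\<And>p. (\<And>g. g \<in> P \<Longrightarrow> poly_at p g = 0) \<Longrightarrow> poly_at p b \<noteq> 0 \<Longrightarrow>
        partial_eval p g \<notin> Q"
      using detecting_polynomial[OF idQ g] by blast
    have "a * b \<notin> P" using P a(1) b(1) by (auto simp: primeideal_class_iff)
    then obtain p where p: "\<And>f. f \<in> P \<Longrightarrow> poly_at p f = 0" "poly_at p (a * b) \<noteq> 0"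
      using exists_point_avoiding[OF P] by blast
    have "partial_eval p (f * g) \<in> Q"
      by (rule partial_eval_sum_ideal[OF idQ p(1) fg])
    then have "partial_eval p f * partial_eval p g \<in> Q"
      by (simp add: partial_eval_def poly_subst_simps)
    moreover have "poly_at p a \<noteq> 0" "poly_at p b \<noteq> 0"
      using p(2) by (auto simp: poly_at_simps)
    then have "partial_eval p f \<notin> Q" "partial_eval p g \<notin> Q"
      using a(2)[OF p(1)] b(2)[OF p(1)] by blast+
    ultimately show False using Q by (auto simp: primeideal_class_iff)
  qed
qed

section \<open>Normal forms adapted to a weight\<close>

lemma finite_exponents_of_degree: "finite {m :: 'v::finite \<Rightarrow>\<^sub>0 nat. weight (\<lambda>_. 1) m = d}"
proof (rule finite_imageD)
  let ?N = "nat \<lfloor>d\<rfloor>"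
  have "lookup m v \<le> ?N" if "weight (\<lambda>_. 1) m = d" for m :: "'v \<Rightarrow>\<^sub>0 nat" and v
  proof (cases "v \<in> keys m")
    case True
    then have "real (lookup m v) \<le> (\<Sum>v\<in>keys m. 1 * real (lookup m v))"
      using member_le_sum[OF True, of "\<lambda>v. real (lookup m v)"] by simp
    then show ?thesis using that by (simp add: weight_def le_nat_floor)
  qed (simp add: in_keys_iff)
  then have "lookup ` {m :: 'v \<Rightarrow>\<^sub>0 nat. weight (\<lambda>_. 1) m = d} \<subseteq> UNIV \<rightarrow>\<^sub>E {..?N}"
    by auto
  then show "finite (lookup ` {m :: 'v \<Rightarrow>\<^sub>0 nat. weight (\<lambda>_. 1) m = d})"
    by (rule finite_subset) (intro finite_PiE finite finite_atMost)
  show "inj_on lookup {m :: 'v \<Rightarrow>\<^sub>0 nat. weight (\<lambda>_. 1) m = d}"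
    by (rule inj_onI) (simp add: poly_mapping_eqI)
qed

text \<open>
  Within one degree, \<open>rank\<close> is an injective numbering in which lower weight means higher rank. It
  breaks ties between monomials of equal weight and provides the induction measure for reduction,
  which replaces a monomial by others of the same degree and lower rank. Degrees have only finitely
  many monomials, so the rank can count the monomials that come later.
\<close>

lemma exists_rank_refining_weight:
  fixes u :: "'v::finite \<Rightarrow> real"
  shows "\<exists>rank :: ('v \<Rightarrow>\<^sub>0 nat) \<Rightarrow> nat. \<forall>m m'. weight (\<lambda>_. 1) m = weight (\<lambda>_. 1) m' \<longrightarrow>
    (rank m = rank m' \<longrightarrow> m = m') \<and> (weight u m < weight u m' \<longrightarrow> rank m' < rank m)"
proof -
  define idx where "idx = to_nat_on (UNIV :: ('v \<Rightarrow>\<^sub>0 nat) set)"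
  have idx: "idx m = idx m' \<longleftrightarrow> m = m'" for m m'
    unfolding idx_def by (simp add: countable_exponents)
  define R where "R m m' \<longleftrightarrow> weight (\<lambda>_. 1) m = weight (\<lambda>_. 1) m' \<and>
    (weight u m < weight u m' \<or> weight u m = weight u m' \<and> idx m < idx m')" for m m'
  define rank where "rank m = card {m'. R m m'}" for m
  have fin: "finite {m'. R m m'}" for m
    by (rule finite_subset[OF _ finite_exponents_of_degree[of "weight (\<lambda>_. 1) m"]])
      (auto simp: R_def)
  have less: "rank m' < rank m" if "R m m'" for m m'
    unfolding rank_def
  proof (rule psubset_card_mono[OF fin])
    have "{x. R m' x} \<subseteq> {x. R m x}" using that by (auto simp: R_def)
    moreover have "m' \<in> {x. R m x}" "m' \<notin> {x. R m' x}" using that by (auto simp: R_def)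
    ultimately show "{x. R m' x} \<subset> {x. R m x}" by blast
  qed
  show ?thesis
  proof (intro exI[of _ rank] allI impI conjI)
    fix m m' assume *: "weight (\<lambda>_. 1) m = weight (\<lambda>_. 1) m'" "rank m = rank m'"
    have "\<not> R m m'" "\<not> R m' m" using less *(2) by fastforce+
    then have "idx m = idx m'" using *(1) by (auto simp: R_def)
    then show "m = m'" by (simp add: idx)
  next
    fix m m' assume "weight (\<lambda>_. 1) m = weight (\<lambda>_. 1) m'" "weight u m < weight u m'"
    then show "rank m' < rank m" by (intro less) (simp add: R_def)
  qed
qed

text \<open>
  The value \<open>n m\<close> is a normal form of the monomial \<open>m\<close> modulo \<open>I\<close>: all its terms have at least the
  weight of \<open>m\<close>, its lowest part is a normal form of \<open>m\<close> modulo \<open>in\<^sub>u(I)\<close>, and the linear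
  extension of \<open>n\<close> kills \<open>I\<close>.
\<close>

definition normal_form_map ::
    "('v \<Rightarrow> real) \<Rightarrow> 'v cpoly set \<Rightarrow> (('v \<Rightarrow>\<^sub>0 nat) \<Rightarrow> 'v cpoly) \<Rightarrow> bool"
  where "normal_form_map u I n \<longleftrightarrow>
    (\<forall>m. order_ge u (weight u m) (n m)) \<and>
    (\<forall>m. part u (weight u m) (n m) - single m 1 \<in> initial_ideal u I) \<and>
    (\<forall>f\<in>I. lin_ext (single 0) n f = 0)"

text \<open>
  Call a monomial standard if it is not the leading monomial, with respect to \<open>rank\<close>, of a form
  in \<open>I\<close>. A nonstandard monomial is congruent to a combination of monomials of the same degree and lower
  rank, so induction on the rank rewrites it into standard ones. No nonzero element of \<open>I\<close> is a combination
  of standard monomials, because \<open>I\<close> contains its homogeneous parts; hence the normal form of an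
  element of \<open>I\<close> vanishes. A leading monomial has the lowest weight in its form, so reduction never
  lowers the weight; the terms of that weight make up an element of \<open>in\<^sub>u(I)\<close>, so modulo \<open>in\<^sub>u(I)\<close>
  reduction does not change the lowest part.
\<close>

lemma exists_normal_form_map:
  fixes I :: "'v::finite cpoly set"
  assumes id: "ideal I cpoly_ring" and hom: "\<And>f k. f \<in> I \<Longrightarrow> part (\<lambda>_. 1) k f \<in> I"
  shows "\<exists>n. normal_form_map u I n"
proof -
  let ?deg = "weight (\<lambda>_. 1)"
  let ?In = "initial_ideal u I"
  note In = ideal_initial_ideal[of u I]
  obtain rank :: "('v \<Rightarrow>\<^sub>0 nat) \<Rightarrow> nat" where
    rank_inj: "\<And>m m'. ?deg m = ?deg m' \<Longrightarrow> rank m = rank m' \<Longrightarrow> m = m'" and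
    rank_weight: "\<And>m m'. ?deg m = ?deg m' \<Longrightarrow> weight u m < weight u m' \<Longrightarrow> rank m' < rank m"
    using exists_rank_refining_weight[of u] by blast
  \<comment> \<open>in particular \<open>f\<close> is homogeneous, so reduction by \<open>f\<close> stays within one degree\<close>
  define lead where "lead f m \<longleftrightarrow>
    lookup f m = 1 \<and> (\<forall>k\<in>keys f - {m}. ?deg k = ?deg m \<and> rank k < rank m)"
    for f :: "'v cpoly" and m
  define standard where "standard = {m. \<forall>f\<in>I. \<not> lead f m}"
  define good where "good m g \<longleftrightarrow> single m 1 - g \<in> I \<and> keys g \<subseteq> standard \<and>
    order_ge u (weight u m) g \<and> part u (weight u m) g - single m 1 \<in> ?In" for m g
  have "\<exists>g. good m g" for m
  proof (induction "rank m" arbitrary: m rule: less_induct)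
    case less
    show ?case
    proof (cases "m \<in> standard")
      case True
      then have "good m (single m 1)"
        by (simp add: good_def part_single order_ge_iff ideal_zero[OF id] ideal_zero[OF In])
      then show ?thesis by blast
    next
      case False
      then obtain f where f: "f \<in> I" "lead f m" by (auto simp: standard_def)
      let ?K = "keys f - {m}" and ?wm = "weight u m"
      have K: "?deg k = ?deg m" "rank k < rank m" if "k \<in> ?K" for k
        using f(2) that by (auto simp: lead_def)
      have wK: "?wm \<le> weight u k" if "k \<in> ?K" for k
        using rank_weight[of k m] K[OF that] by force
      have "\<forall>k. \<exists>g. k \<in> ?K \<longrightarrow> good k g" using less K(2) by blast
      then obtain n where "\<forall>k. k \<in> ?K \<longrightarrow> good k (n k)"
        by (rule choice[THEN exE])
      then have n: "single k 1 - n k \<in> I" "keys (n k) \<subseteq> standard" "order_ge u (weight u k) (n k)"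
        "part u (weight u k) (n k) - single k 1 \<in> ?In" if "k \<in> ?K" for k
        using that by (auto simp: good_def)
      define g where "g = - (\<Sum>k\<in>?K. single 0 (lookup f k) * n k)"
      have "m \<in> keys f" "lookup f m = 1" using f(2) by (auto simp: lead_def in_keys_iff)
      then have f_eq: "f = single m 1 + (\<Sum>k\<in>?K. single 0 (lookup f k) * single k 1)"
        using cpoly_sum[of f] by (simp add: sum.remove mult_single)
      have "f - (\<Sum>k\<in>?K. single 0 (lookup f k) * (single k 1 - n k)) \<in> I"
        by (intro ideal_diff[OF id f(1)] ideal_sum[OF id] ideal_mult[OF id] n(1))
      also have "f - (\<Sum>k\<in>?K. single 0 (lookup f k) * (single k 1 - n k)) = single m 1 - g"
        by (subst (1) f_eq) (simp add: g_def right_diff_distrib sum_subtractf)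
      finally have 1: "single m 1 - g \<in> I" .
      have 2: "keys g \<subseteq> standard"
      proof
        fix k assume "k \<in> keys g"
        then have "(\<Sum>k'\<in>?K. lookup f k' * lookup (n k') k) \<noteq> 0"
          by (simp add: g_def in_keys_iff lookup_sum lookup_const_mult)
        then obtain k' where "k' \<in> ?K" "lookup (n k') k \<noteq> 0"
          by (metis (no_types, lifting) mult_zero_right sum.neutral)
        then show "k \<in> standard" using n(2)[of k'] by (metis in_keys_iff subsetD)
      qed
      have 3: "order_ge u ?wm g"
        unfolding g_def order_ge_def
      proof (intro allI impI)
        fix l assume l: "l < ?wm"
        have "part u l (n k) = 0" if "k \<in> ?K" for k
          using n(3)[OF that] wK[OF that] l by (simp add: order_ge_def)
        then show "part u l (- (\<Sum>k\<in>?K. single 0 (lookup f k) * n k)) = 0"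
          by (simp add: part_uminus part_sum part_const_mult)
      qed
      have "order_ge u ?wm f"
        unfolding order_ge_iff
      proof
        fix k assume "k \<in> keys f"
        then show "?wm \<le> weight u k" using wK[of k] by (cases "k = m") auto
      qed
      then have f_in: "part u ?wm f \<in> ?In" by (rule part_in_initial_ideal[OF f(1)])
      have diff: "part u ?wm (n k) - part u ?wm (single k 1) \<in> ?In" if "k \<in> ?K" for k
      proof (cases "weight u k = ?wm")
        case True
        then show ?thesis using n(4)[OF that] by (simp add: part_single)
      next
        case False
        then show ?thesis
          using n(3)[OF that] wK[OF that] ideal_zero[OF In] by (simp add: order_ge_def part_single)
      qed
      have "- (\<Sum>k\<in>?K. single 0 (lookup f k) * (part u ?wm (n k) - part u ?wm (single k 1))) - part u ?wm f \<in> ?In"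
        by (intro ideal_diff[OF In _ f_in] ideal_uminus[OF In] ideal_sum[OF In] ideal_mult[OF In] diff)
      also have "- (\<Sum>k\<in>?K. single 0 (lookup f k) * (part u ?wm (n k) - part u ?wm (single k 1))) - part u ?wm f
          = part u ?wm g - single m 1"
        by (subst (2) f_eq) (simp add: g_def part_add part_uminus part_sum part_const_mult
            part_single[of _ _ m] right_diff_distrib sum_subtractf)
      finally have 4: "part u ?wm g - single m 1 \<in> ?In" .
      show ?thesis using 1 2 3 4 good_def by blast
    qed
  qed
  then obtain n where n: "\<And>m. good m (n m)" by metis
  have "lin_ext (single 0) n f = 0" if f: "f \<in> I" for f
  proof (rule ccontr)
    let ?g = "lin_ext (single 0) n f"
    assume "?g \<noteq> 0"
    then obtain m1 where m1: "m1 \<in> keys ?g" using keys_eq_empty by blast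
    have "f - (\<Sum>m\<in>keys f. single 0 (lookup f m) * (single m 1 - n m)) \<in> I"
      using n by (intro ideal_diff[OF id f] ideal_sum[OF id] ideal_mult[OF id]) (auto simp: good_def)
    also have "f - (\<Sum>m\<in>keys f. single 0 (lookup f m) * (single m 1 - n m)) = ?g"
      using cpoly_sum[of f] by (simp add: lin_ext_def right_diff_distrib sum_subtractf mult_single)
    finally have gI: "?g \<in> I" .
    have g_standard: "keys ?g \<subseteq> standard"
    proof
      fix k assume "k \<in> keys ?g"
      then have "(\<Sum>m\<in>keys f. lookup f m * lookup (n m) k) \<noteq> 0"
        by (simp add: lin_ext_def in_keys_iff lookup_sum lookup_const_mult)
      then obtain m where "m \<in> keys f" "lookup (n m) k \<noteq> 0"
        by (metis (no_types, lifting) mult_zero_right sum.neutral)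
      then show "k \<in> standard" using n[of m] by (metis good_def in_keys_iff subsetD)
    qed
    define h where "h = part (\<lambda>_. 1) (?deg m1) ?g"
    have hI: "h \<in> I" unfolding h_def by (rule hom[OF gI])
    have keys_h: "keys h = {m \<in> keys ?g. ?deg m = ?deg m1}" by (simp add: h_def keys_part)
    obtain m where m: "m \<in> keys h" and max: "\<And>k. k \<in> keys h \<Longrightarrow> rank k \<le> rank m"
    proof -
      have "rank ` keys h \<noteq> {}" using m1 keys_h by auto
      then have "Max (rank ` keys h) \<in> rank ` keys h" by (intro Max_in) auto
      then obtain m where "m \<in> keys h" "rank m = Max (rank ` keys h)" by auto
      then show ?thesis using that[of m] by simp
    qed
    let ?h = "single 0 (inverse (lookup h m)) * h"
    have "lead ?h m"
      unfolding lead_def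
    proof (intro conjI ballI)
      show "lookup ?h m = 1" using m by (simp add: lookup_const_mult in_keys_iff)
      fix k assume "k \<in> keys ?h - {m}"
      then have k: "k \<in> keys h" "k \<noteq> m" by (auto simp: in_keys_iff lookup_const_mult)
      then show deg: "?deg k = ?deg m" using m keys_h by simp
      show "rank k < rank m" using max[OF k(1)] rank_inj[OF deg] k(2) by fastforce
    qed
    moreover have "?h \<in> I" by (rule ideal_mult[OF id hI])
    ultimately have "m \<notin> standard" by (auto simp: standard_def)
    then show False using m keys_h g_standard by blast
  qed
  then have "normal_form_map u I n"
    using n by (simp add: normal_form_map_def good_def)
  then show ?thesis by blast
qed

section \<open>Initial forms of a sum of ideals in disjoint variables\<close>

lemma part_left_incl: "part (case_sum u v) k (left_incl f) = left_incl (part u k f)"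
  and part_right_incl: "part (case_sum u v) k (right_incl g) = right_incl (part v k g)"
  unfolding var_poly_def monom_poly_def part_poly_subst by (simp_all add: weight_single del: One_nat_def)

lemma order_ge_left_incl: "order_ge u k f \<Longrightarrow> order_ge (case_sum u v) k (left_incl f)"
  and order_ge_right_incl: "order_ge v k g \<Longrightarrow> order_ge (case_sum u v) k (right_incl g)"
  by (simp_all add: order_ge_def part_left_incl part_right_incl poly_subst_simps)

lemma weight_case_sum: "weight (case_sum u v) m = weight u (left_exp m) + weight v (right_exp m)"
proof -
  have "weight (case_sum u v) (inl_exp (left_exp m) + inr_exp (right_exp m)) =
      weight u (left_exp m) + weight v (right_exp m)"
    by (simp add: weight_add inl_exp_def inr_exp_def weight_of_exp_map weight_single del: One_nat_def)
  then show ?thesis by (simp add: exponent_split)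
qed

text \<open>
  The tensor product of two linear maps, applied to a multiple of \<open>left_incl f\<close>: the right factor
  is inert.
\<close>

lemma lin_ext_split_left:
  "lin_ext (single 0) (\<lambda>m. left_incl (a (left_exp m)) * right_incl (b (right_exp m))) (single m c * left_incl f)
    = left_incl (lin_ext (single 0) a (single (left_exp m) c * f)) * right_incl (b (right_exp m))"
  by (induction f rule: cpoly_induct)
    (simp_all add: poly_subst_simps subst.lin_ext_zero subst.lin_ext_add ring_distribs mult_single
      left_incl_single subst.lin_ext_single left_exp_add right_exp_add mult.assoc inl_exp_zero)

lemma lin_ext_split_right:
  "lin_ext (single 0) (\<lambda>m. left_incl (a (left_exp m)) * right_incl (b (right_exp m))) (single m c * right_incl g)
    = left_incl (a (left_exp m)) * right_incl (lin_ext (single 0) b (single (right_exp m) c * g))"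
  by (induction g rule: cpoly_induct)
    (simp_all add: poly_subst_simps subst.lin_ext_zero subst.lin_ext_add ring_distribs mult_single
      right_incl_single subst.lin_ext_single left_exp_add right_exp_add mult_ac inr_exp_zero add.commute)

text \<open>
  The tensor product of normal form maps for \<open>I\<close> and \<open>J\<close> kills \<open>I + J\<close>. It does not lower
  weights, and on pieces of weight \<open>\<mu>\<close> it is the identity modulo \<open>in\<^sub>u(I) + in\<^sub>v(J)\<close>. Applied to
  \<open>f\<close>, the piece of weight \<open>\<mu>\<close> of the image is therefore both \<open>0\<close> and congruent to the piece of \<open>f\<close>.
\<close>

theorem part_sum_ideal:
  fixes I :: "'n::finite cpoly set" and J :: "'m::finite cpoly set"
  assumes I: "homogeneous_ideal I" and J: "homogeneous_ideal J"
    and f: "f \<in> sum_ideal I J" and ge: "order_ge (case_sum u v) \<mu> f"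
  shows "part (case_sum u v) \<mu> f \<in> sum_ideal (initial_ideal u I) (initial_ideal v J)"
proof -
  let ?S = "sum_ideal (initial_ideal u I) (initial_ideal v J)"
  let ?w = "case_sum u v"
  note S = ideal_sum_ideal[of "initial_ideal u I" "initial_ideal v J"]
  from I have idI: "ideal I cpoly_ring" and "\<And>f k. f \<in> I \<Longrightarrow> part (\<lambda>_. 1) k f \<in> I"
    by (auto simp: homogeneous_ideal_iff)
  then obtain a where "normal_form_map u I a"
    using exists_normal_form_map by blast
  then have a: "order_ge u (weight u m) (a m)"
    "part u (weight u m) (a m) - single m 1 \<in> initial_ideal u I"
    "f \<in> I \<Longrightarrow> lin_ext (single 0) a f = 0" for m f
    by (auto simp: normal_form_map_def)
  from J have idJ: "ideal J cpoly_ring" and "\<And>f k. f \<in> J \<Longrightarrow> part (\<lambda>_. 1) k f \<in> J"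
    by (auto simp: homogeneous_ideal_iff)
  then obtain b where "normal_form_map v J b"
    using exists_normal_form_map by blast
  then have b: "order_ge v (weight v m) (b m)"
    "part v (weight v m) (b m) - single m 1 \<in> initial_ideal v J"
    "f \<in> J \<Longrightarrow> lin_ext (single 0) b f = 0" for m f
    by (auto simp: normal_form_map_def)
  define t where "t m = left_incl (a (left_exp m)) * right_incl (b (right_exp m))" for m
  have "lin_ext (single 0) t f = 0"
    using f unfolding sum_ideal_genideal
  proof (induction f rule: genideal_induct)
    case (mult m c s)
    then show ?case
      unfolding t_def
      by (auto simp: lin_ext_split_left lin_ext_split_right poly_subst_simps
          a(3)[OF ideal_mult[OF idI]] b(3)[OF ideal_mult[OF idJ]])
  qed (simp_all add: subst.lin_ext_zero subst.lin_ext_add)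
  then have "part ?w \<mu> (lin_ext (single 0) t f) = 0"
    by (simp add: part_zero)
  then have "(\<Sum>m\<in>keys f. single 0 (lookup f m) * part ?w \<mu> (t m)) = 0"
    by (simp add: lin_ext_def part_sum part_const_mult)
  moreover have "part ?w \<mu> f = (\<Sum>m\<in>keys f. single 0 (lookup f m) * part ?w \<mu> (single m 1))"
  proof -
    have "part ?w \<mu> f = (\<Sum>m\<in>keys f. part ?w \<mu> (single m (lookup f m)))"
      using arg_cong[OF cpoly_sum[of f], of "part ?w \<mu>"] unfolding part_sum .
    also have "\<dots> = (\<Sum>m\<in>keys f. single 0 (lookup f m) * part ?w \<mu> (single m 1))"
      by (intro sum.cong refl) (simp add: part_single mult_single)
    finally show ?thesis .
  qed
  moreover have "(\<Sum>m\<in>keys f. single 0 (lookup f m) * (part ?w \<mu> (single m 1) - part ?w \<mu> (t m))) \<in> ?S"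
  proof (intro ideal_sum[OF S] ideal_mult[OF S])
    fix m assume "m \<in> keys f"
    then have m: "\<mu> \<le> weight ?w m" using ge by (simp add: order_ge_iff)
    let ?k = "weight u (left_exp m)" and ?l = "weight v (right_exp m)"
    have t_ge: "order_ge ?w (weight ?w m) (t m)"
      unfolding t_def weight_case_sum
      by (intro order_ge_mult order_ge_left_incl order_ge_right_incl a b)
    show "part ?w \<mu> (single m 1) - part ?w \<mu> (t m) \<in> ?S"
    proof (cases "\<mu> = weight ?w m")
      case False
      then show ?thesis
        using t_ge m ideal_zero[OF S] by (simp add: order_ge_def part_single)
    next
      case True
      let ?x = "single (left_exp m) 1" and ?y = "single (right_exp m) 1"
      let ?X = "part u ?k (a (left_exp m))" and ?Y = "part v ?l (b (right_exp m))"
      have "part ?w \<mu> (t m) = left_incl ?X * right_incl ?Y"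
        unfolding t_def True weight_case_sum
        by (simp add: part_mult[OF order_ge_left_incl[OF a(1)] order_ge_right_incl[OF b(1)]]
            part_left_incl part_right_incl)
      moreover have "part ?w \<mu> (single m 1) = left_incl ?x * right_incl ?y"
        by (simp add: True part_single left_incl_single right_incl_single mult_single exponent_split)
      moreover have "left_incl ?X * right_incl ?Y - left_incl ?x * right_incl ?y =
          left_incl (?X - ?x) * right_incl ?Y + left_incl ?x * right_incl (?Y - ?y)"
        by (simp add: poly_subst_simps algebra_simps)
      moreover have "\<dots> \<in> ?S"
        by (intro ideal_add[OF S] ideal_mult[OF S] ideal_mult_right[OF S]
            left_incl_in_sum_ideal right_incl_in_sum_ideal a b)
      ultimately show ?thesis using ideal_uminus[OF S] by (metis minus_diff_eq)
    qed
  qed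
  ultimately show ?thesis by (simp add: right_diff_distrib sum_subtractf)
qed

section \<open>The Segre homomorphism and its kernel\<close>

definition segre_exp :: "('n \<times> 'm \<Rightarrow>\<^sub>0 nat) \<Rightarrow> ('n + 'm \<Rightarrow>\<^sub>0 nat)"
  where "segre_exp = exp_map (\<lambda>(i, j). single (Inl i) 1 + single (Inr j) 1)"

definition segre_weight :: "('n \<Rightarrow> real) \<Rightarrow> ('m \<Rightarrow> real) \<Rightarrow> 'n \<times> 'm \<Rightarrow> real"
  where "segre_weight u v = (\<lambda>(i, j). u i + v j)"

text \<open>
  The degree in \<open>x\<close> minus the degree in \<open>y\<close>, as a weight. The image of the Segre homomorphism is
  the piece of weight \<open>0\<close>.
\<close>

definition bidegree_diff :: "'n + 'm \<Rightarrow> real"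
  where "bidegree_diff = case_sum (\<lambda>_. 1) (\<lambda>_. - 1)"

lemma segre_subst_alt:
  "segre_subst = poly_subst (\<lambda>p. single (case p of (i, j) \<Rightarrow> single (Inl i) 1 + single (Inr j) 1) 1)"
  by (simp add: segre_subst_def var_poly_def monom_poly_def mult_single case_prod_unfold
      del: One_nat_def)

lemma segre_subst_single: "segre_subst (single m c) = single (segre_exp m) c"
  unfolding segre_subst_alt segre_exp_def by (rule poly_subst_single)

lemma segre_subst_simps:
  "segre_subst 0 = 0" "segre_subst (f + g) = segre_subst f + segre_subst g"
  "segre_subst (f - g) = segre_subst f - segre_subst g"
  by (simp_all add: segre_subst_def poly_subst_simps)

lemma weight_segre_exp: "weight (case_sum u v) (segre_exp m) = weight (segre_weight u v) m"
  by (simp add: segre_exp_def segre_weight_def weight_of_exp_map case_prod_unfold weight_add weight_single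
      del: One_nat_def)

lemma part_segre_subst: "part (case_sum u v) k (segre_subst f) = segre_subst (part (segre_weight u v) k f)"
  by (rule part_linear)
    (simp_all add: segre_subst_simps part_single segre_subst_single weight_segre_exp)

lemma segre_exp_bidegree: "weight bidegree_diff (segre_exp m) = 0"
  unfolding bidegree_diff_def weight_segre_exp
  by (simp add: segre_weight_def weight_def case_prod_unfold)

lemma segre_ideal_iff: "f \<in> segre_ideal I J \<longleftrightarrow> segre_subst f \<in> sum_ideal I J"
proof -
  interpret ideal "sum_ideal I J" "cpoly_ring :: ('a + 'b) cpoly ring" by (rule ideal_sum_ideal)
  have "f \<in> segre_ideal I J \<longleftrightarrow>
      sum_ideal I J +>\<^bsub>cpoly_ring\<^esub> segre_subst f = sum_ideal I J"
    by (simp add: segre_ideal_def a_kernel_def' FactRing_def carrier_class)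
  also have "\<dots> \<longleftrightarrow> segre_subst f \<in> sum_ideal I J"
    using rcos_const_imp_mem[of "segre_subst f"] a_rcos_const[of "segre_subst f"]
    by (auto simp: carrier_class)
  finally show ?thesis .
qed

lemma segre_ideal_vimage: "segre_ideal I J = segre_subst -` sum_ideal I J"
  by (auto simp: segre_ideal_iff)

lemma ideal_segre_ideal: "ideal (segre_ideal I J) cpoly_ring"
  unfolding segre_ideal_vimage segre_subst_def by (rule ideal_poly_subst_vimage[OF ideal_sum_ideal])

lemma primeideal_segre_ideal:
  fixes P :: "'n::finite cpoly set" and Q :: "'m cpoly set"
  assumes "primeideal P cpoly_ring" "primeideal Q cpoly_ring"
  shows "primeideal (segre_ideal P Q) cpoly_ring"
  unfolding segre_ideal_vimage segre_subst_def
  by (rule primeideal_poly_subst_vimage[OF primeideal_sum_ideal[OF assms]])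

lemma part_neg_one: "part (\<lambda>_. - 1) k f = part (\<lambda>_. 1) (- k) f"
proof -
  have "weight (\<lambda>_. - 1) m = - weight (\<lambda>_. 1) m" for m :: "'a \<Rightarrow>\<^sub>0 nat"
    by (simp add: weight_def sum_negf)
  then show ?thesis
    by (intro poly_mapping_eqI) (auto simp: lookup_part)
qed

text \<open>
  Two gradings are needed: equal signs give the total degree, opposite signs the difference of the
  degrees in \<open>x\<close> and \<open>y\<close>.
\<close>

lemma sum_ideal_part_closed:
  assumes I: "homogeneous_ideal I" and J: "homogeneous_ideal J"
    and u: "u = 1 \<or> u = - 1" and v: "v = 1 \<or> v = - 1" and f: "f \<in> sum_ideal I J"
  shows "part (case_sum (\<lambda>_. u) (\<lambda>_. v)) k f \<in> sum_ideal I J"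
proof -
  have I': "part (\<lambda>_. u) k f \<in> I" if "f \<in> I" for f k
    using I u that by (auto simp: homogeneous_ideal_iff part_neg_one)
  have J': "part (\<lambda>_. v) k f \<in> J" if "f \<in> J" for f k
    using J v that by (auto simp: homogeneous_ideal_iff part_neg_one)
  show ?thesis
    using f unfolding sum_ideal_genideal
    by (rule genideal_part_closed[rotated])
      (auto simp: part_left_incl part_right_incl intro!: in_genideal I' J')
qed

text \<open>The Segre homomorphism doubles degrees.\<close>

lemma homogeneous_segre_ideal:
  assumes "homogeneous_ideal I" "homogeneous_ideal J"
  shows "homogeneous_ideal (segre_ideal I J)"
  unfolding homogeneous_ideal_iff
proof (intro conjI ballI allI ideal_segre_ideal)
  fix f k assume f: "f \<in> segre_ideal I J"
  have "weight (segre_weight (\<lambda>_. 1) (\<lambda>_. 1)) m = 2 * weight (\<lambda>_. 1) m" for m :: "'a \<times> 'b \<Rightarrow>\<^sub>0 nat"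
    by (simp add: weight_def segre_weight_def case_prod_unfold sum_distrib_left)
  then have part2: "part (\<lambda>_. 1) k f = part (segre_weight (\<lambda>_. 1) (\<lambda>_. 1)) (2 * k) f"
    by (intro poly_mapping_eqI) (simp add: lookup_part)
  have "part (case_sum (\<lambda>_. 1) (\<lambda>_. 1)) (2 * k) (segre_subst f) \<in> sum_ideal I J"
    by (rule sum_ideal_part_closed[OF assms]) (use f in \<open>simp_all add: segre_ideal_iff\<close>)
  then show "part (\<lambda>_. 1) k f \<in> segre_ideal I J"
    by (simp only: segre_ideal_iff part2 part_segre_subst)
qed

subsection \<open>Lifting monomials along the Segre homomorphism\<close>

lemma exponent_remove:
  fixes m :: "'v \<Rightarrow>\<^sub>0 nat"
  assumes "m \<noteq> 0"
  obtains m' v where "m = m' + single v 1"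
proof -
  have "m \<noteq> 0 \<longrightarrow> (\<exists>m' v. m = m' + single v 1)"
  proof (induction m rule: exponent_induct)
    case (single v)
    show ?case by (intro impI exI[of _ 0] exI[of _ v]) simp
  next
    case (add a b)
    show ?case
    proof (cases "b = 0")
      case False
      then obtain m' v where "b = m' + single v 1" using add by blast
      then have "a + b = (a + m') + single v 1" by (simp add: add.assoc)
      then show ?thesis by blast
    qed (use add in simp)
  qed simp
  then show ?thesis using assms that by blast
qed

lemma weight_one_eq_0_iff: "weight (\<lambda>_. 1) m = 0 \<longleftrightarrow> m = 0"
  by (auto simp: weight_def sum_nonneg_eq_0_iff in_keys_iff simp flip: keys_eq_empty)

text \<open>Pair the variables of the two monomials off, one \<open>x\<^sub>i\<close> with one \<open>y\<^sub>j\<close> at a time.\<close>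

lemma exists_segre_lift_aux:
  "weight (\<lambda>_. 1) a = real d \<Longrightarrow> weight (\<lambda>_. 1) b = real d \<Longrightarrow> \<exists>\<alpha>. segre_exp \<alpha> = inl_exp a + inr_exp b"
proof (induction d arbitrary: a b)
  case 0
  then have "a = 0" "b = 0" by (simp_all add: weight_one_eq_0_iff)
  then show ?case by (intro exI[of _ 0]) (simp add: segre_exp_def exp_map_zero inl_exp_zero inr_exp_zero)
next
  case (Suc d)
  then have "a \<noteq> 0" "b \<noteq> 0" by (auto simp: weight_zero)
  then obtain a' i b' j where ab: "a = a' + single i 1" "b = b' + single j 1"
    using exponent_remove[of a] exponent_remove[of b] by metis
  then have "weight (\<lambda>_. 1) a' = real d" "weight (\<lambda>_. 1) b' = real d"
    using Suc.prems by (simp_all add: weight_add weight_single del: One_nat_def)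
  then obtain \<alpha> where "segre_exp \<alpha> = inl_exp a' + inr_exp b'" using Suc.IH by blast
  then have "segre_exp (\<alpha> + single (i, j) 1) = inl_exp a + inr_exp b"
    by (simp add: ab segre_exp_def inl_exp_def inr_exp_def exp_map_add exp_map_single ac_simps
        del: One_nat_def)
  then show ?case by blast
qed

lemma exists_segre_lift:
  assumes "weight bidegree_diff m = 0"
  shows "\<exists>\<alpha>. segre_exp \<alpha> = m"
proof -
  have "weight (\<lambda>_. - 1) (right_exp m) = - weight (\<lambda>_. 1) (right_exp m)"
    by (simp add: weight_def sum_negf)
  then have "weight (\<lambda>_. 1) (left_exp m) = weight (\<lambda>_. 1) (right_exp m)"
    using assms by (simp add: bidegree_diff_def weight_case_sum)
  moreover have "weight (\<lambda>_. 1) (left_exp m) = real (\<Sum>v\<in>keys (left_exp m). lookup (left_exp m) v)"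
    by (simp add: weight_def)
  ultimately show ?thesis
    using exists_segre_lift_aux[of "left_exp m" _ "right_exp m"] exponent_split[of m] by metis
qed

definition segre_lift_exp :: "('n + 'm \<Rightarrow>\<^sub>0 nat) \<Rightarrow> ('n \<times> 'm \<Rightarrow>\<^sub>0 nat)"
  where "segre_lift_exp m = (SOME \<alpha>. segre_exp \<alpha> = m)"

lemma segre_exp_lift: "weight bidegree_diff m = 0 \<Longrightarrow> segre_exp (segre_lift_exp m) = m"
  unfolding segre_lift_exp_def by (rule someI_ex[OF exists_segre_lift])

text \<open>
  A linear section of the Segre homomorphism over its image; the remaining monomials go to \<open>0\<close>,
  which makes the composition with the Segre homomorphism the projection to bidegree difference \<open>0\<close>.
\<close>

definition segre_lift :: "('n + 'm) cpoly \<Rightarrow> ('n \<times> 'm) cpoly"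
  where "segre_lift = lin_ext (single 0)
    (\<lambda>m. if weight bidegree_diff m = 0 then single (segre_lift_exp m) 1 else 0)"

lemma segre_lift_zero: "segre_lift 0 = 0"
  and segre_lift_add: "segre_lift (f + g) = segre_lift f + segre_lift g"
  and segre_lift_single: "segre_lift (single m c) =
    (if weight bidegree_diff m = 0 then single (segre_lift_exp m) c else 0)"
  by (simp_all add: segre_lift_def subst.lin_ext_zero subst.lin_ext_add subst.lin_ext_single mult_single)

lemma segre_subst_lift: "segre_subst (segre_lift f) = part bidegree_diff 0 f"
  by (induction f rule: cpoly_induct)
    (simp_all add: segre_subst_simps segre_lift_zero segre_lift_add segre_lift_single
      segre_subst_single segre_exp_lift part_zero part_add part_single)

lemma part_segre_lift: "part (segre_weight u v) k (segre_lift f) = segre_lift (part (case_sum u v) k f)"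
proof (rule part_linear)
  fix m c
  have "weight (segre_weight u v) (segre_lift_exp m) = weight (case_sum u v) m"
    if "weight bidegree_diff m = 0"
    using segre_exp_lift[OF that] weight_segre_exp[of u v "segre_lift_exp m"] by simp
  then show "part (segre_weight u v) k (segre_lift (single m c)) = segre_lift (part (case_sum u v) k (single m c))"
    by (simp add: segre_lift_single segre_lift_zero part_single part_zero)
qed (simp_all add: segre_lift_zero segre_lift_add)

lemma segre_binomial:
  assumes "segre_exp \<alpha> = segre_exp \<beta>"
  shows "single \<alpha> c - single \<beta> c \<in> segre_ideal I J"
  using assms ideal_zero[OF ideal_sum_ideal]
  by (simp add: segre_ideal_iff segre_subst_simps segre_subst_single)

section \<open>Initial ideals of the Segre ideal\<close>

text \<open>
  Lifting the image of a monomial gives a monomial of the same weight. Their difference lies in the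
  Segre ideal and is its own initial form.
\<close>

lemma diff_segre_lift_subst:
  "f - segre_lift (segre_subst f) \<in> initial_ideal (segre_weight u v) (segre_ideal I J)"
proof (induction f rule: cpoly_induct)
  case zero
  then show ?case by (simp add: segre_subst_simps segre_lift_zero ideal_zero[OF ideal_initial_ideal])
next
  case (single m c)
  let ?m = "segre_lift_exp (segre_exp m)" and ?w = "segre_weight u v"
  have m: "segre_exp ?m = segre_exp m" by (rule segre_exp_lift[OF segre_exp_bidegree])
  have w: "weight ?w ?m = weight ?w m"
    using arg_cong[OF m, of "weight (case_sum u v)"] by (simp only: weight_segre_exp)
  have "order_ge ?w (weight ?w m) (single m c - single ?m c)"
    by (simp add: order_ge_def part_diff part_single w)
  then have "part ?w (weight ?w m) (single m c - single ?m c) \<in> initial_ideal ?w (segre_ideal I J)"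
    by (intro part_in_initial_ideal segre_binomial) (simp_all add: m)
  then show ?case
    by (simp add: segre_subst_single segre_lift_single segre_exp_bidegree part_diff part_single w)
next
  case (add f g)
  then show ?case
    using ideal_add[OF ideal_initial_ideal add]
    by (simp add: segre_subst_simps segre_lift_add algebra_simps)
qed

lemma sum_initial_ideals_subset:
  assumes "ideal I cpoly_ring" "ideal J cpoly_ring"
  shows "sum_ideal (initial_ideal u I) (initial_ideal v J) \<subseteq> initial_ideal (case_sum u v) (sum_ideal I J)"
proof (rule sum_ideal_subset[OF ideal_initial_ideal])
  note A = ideal_initial_ideal[of "case_sum u v" "sum_ideal I J"]
  fix f assume "f \<in> initial_ideal u I"
  then show "left_incl f \<in> initial_ideal (case_sum u v) (sum_ideal I J)"
    using assms(1)
  proof (induction f rule: initial_ideal_induct)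
    case (part f \<mu>)
    then show ?case
      unfolding part_left_incl[of u v, symmetric]
      by (intro part_in_initial_ideal left_incl_in_sum_ideal order_ge_left_incl)
  qed (simp_all add: poly_subst_simps ideal_zero[OF A] ideal_add[OF A])
next
  note A = ideal_initial_ideal[of "case_sum u v" "sum_ideal I J"]
  fix f assume "f \<in> initial_ideal v J"
  then show "right_incl f \<in> initial_ideal (case_sum u v) (sum_ideal I J)"
    using assms(2)
  proof (induction f rule: initial_ideal_induct)
    case (part f \<mu>)
    then show ?case
      unfolding part_right_incl[of u v, symmetric]
      by (intro part_in_initial_ideal right_incl_in_sum_ideal order_ge_right_incl)
  qed (simp_all add: poly_subst_simps ideal_zero[OF A] ideal_add[OF A])
qed

text \<open>
  An element of \<open>in\<^sub>u(I) + in\<^sub>v(J)\<close> is a sum of lowest pieces of elements \<open>f\<close> of \<open>I + J\<close>. The lift of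
  \<open>f\<close> lies in the Segre ideal because \<open>I + J\<close> contains the piece of \<open>f\<close> of bidegree difference
  \<open>0\<close>, and lifting preserves weights.
\<close>

lemma segre_lift_initial:
  assumes I: "homogeneous_ideal I" and J: "homogeneous_ideal J"
    and f: "f \<in> sum_ideal (initial_ideal u I) (initial_ideal v J)"
  shows "segre_lift f \<in> initial_ideal (segre_weight u v) (segre_ideal I J)"
proof -
  note A = ideal_initial_ideal[of "segre_weight u v" "segre_ideal I J"]
  have "f \<in> initial_ideal (case_sum u v) (sum_ideal I J)"
    using sum_initial_ideals_subset[of I J u v] f I J by (auto simp: homogeneous_ideal_iff)
  then show ?thesis
    using ideal_sum_ideal[of I J]
  proof (induction f rule: initial_ideal_induct)
    case (part f \<mu>)
    have "segre_lift f \<in> segre_ideal I J"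
      unfolding segre_ideal_iff segre_subst_lift bidegree_diff_def
      by (rule sum_ideal_part_closed[OF I J]) (simp_all add: part)
    moreover have "order_ge (segre_weight u v) \<mu> (segre_lift f)"
      using part(2) by (simp add: order_ge_def part_segre_lift segre_lift_zero)
    ultimately show ?case
      unfolding part_segre_lift[symmetric] by (rule part_in_initial_ideal)
  qed (simp_all add: segre_lift_zero segre_lift_add ideal_zero[OF A] ideal_add[OF A])
qed

theorem initial_segre_ideal:
  fixes I :: "'n::finite cpoly set" and J :: "'m::finite cpoly set"
  assumes I: "homogeneous_ideal I" and J: "homogeneous_ideal J"
  shows "initial_ideal (segre_weight u v) (segre_ideal I J)
    = segre_ideal (initial_ideal u I) (initial_ideal v J)"
proof
  show "initial_ideal (segre_weight u v) (segre_ideal I J)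
      \<subseteq> segre_ideal (initial_ideal u I) (initial_ideal v J)"
  proof (rule initial_ideal_subset[OF ideal_segre_ideal])
    fix f \<mu> assume f: "f \<in> segre_ideal I J" "order_ge (segre_weight u v) \<mu> f"
    then have "order_ge (case_sum u v) \<mu> (segre_subst f)"
      by (simp add: order_ge_def part_segre_subst segre_subst_simps)
    then show "part (segre_weight u v) \<mu> f \<in> segre_ideal (initial_ideal u I) (initial_ideal v J)"
      using f(1) unfolding segre_ideal_iff part_segre_subst[symmetric]
      by (intro part_sum_ideal[OF I J])
  qed
  show "segre_ideal (initial_ideal u I) (initial_ideal v J)
      \<subseteq> initial_ideal (segre_weight u v) (segre_ideal I J)"
  proof
    fix f assume "f \<in> segre_ideal (initial_ideal u I) (initial_ideal v J)"
    then have "segre_lift (segre_subst f) \<in> initial_ideal (segre_weight u v) (segre_ideal I J)"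
      unfolding segre_ideal_iff by (rule segre_lift_initial[OF I J])
    then show "f \<in> initial_ideal (segre_weight u v) (segre_ideal I J)"
      using ideal_cong[OF ideal_initial_ideal diff_segre_lift_subst] by blast
  qed
qed

section \<open>Tropical points of the Segre ideal\<close>

text \<open>Otherwise one term of the binomial would be an initial form.\<close>

lemma Trop_segre_equal_weights:
  assumes w: "w \<in> Trop (segre_ideal I J)" and eq: "segre_exp \<alpha> = segre_exp \<beta>"
  shows "weight w \<alpha> = weight w \<beta>"
proof -
  have "\<not> weight w \<alpha> < weight w \<beta>" if "segre_exp \<alpha> = segre_exp \<beta>" for \<alpha> \<beta> :: "'a \<times> 'b \<Rightarrow>\<^sub>0 nat"
  proof
    assume less: "weight w \<alpha> < weight w \<beta>"
    then have "order_ge w (weight w \<alpha>) (single \<alpha> 1 - single \<beta> 1)"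
      by (simp add: order_ge_def part_diff part_single)
    then have "part w (weight w \<alpha>) (single \<alpha> 1 - single \<beta> 1) \<in> initial_ideal w (segre_ideal I J)"
      by (intro part_in_initial_ideal segre_binomial that)
    then have "monom_poly \<alpha> \<in> initial_ideal w (segre_ideal I J)"
      using less by (simp add: part_diff part_single monom_poly_def)
    then show False using w by (simp add: Trop_def)
  qed
  from this[of \<alpha> \<beta>] this[of \<beta> \<alpha>] eq show ?thesis by force
qed

lemma Trop_segre_weight:
  fixes w :: "'n \<times> 'm \<Rightarrow> real"
  assumes w: "w \<in> Trop (segre_ideal I J)"
  obtains u v where "w = segre_weight u v"
proof -
  fix i0 :: 'n and j0 :: 'm
  let ?u = "\<lambda>i. w (i, j0)" and ?v = "\<lambda>j. w (i0, j) - w (i0, j0)"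
  have uv: "w (i, j) = ?u i + ?v j" for i j
  proof -
    have "segre_exp (single (i, j) 1 + single (i0, j0) 1) = segre_exp (single (i, j0) 1 + single (i0, j) 1)"
      by (simp add: segre_exp_def exp_map_add exp_map_single ac_simps del: One_nat_def)
    from Trop_segre_equal_weights[OF w this] show ?thesis
      by (simp add: weight_add weight_single del: One_nat_def)
  qed
  have "w = segre_weight ?u ?v"
  proof
    fix p :: "'n \<times> 'm"
    obtain i j where "p = (i, j)" by (rule prod.exhaust)
    then show "w p = segre_weight ?u ?v p" using uv[of i j] by (simp only: segre_weight_def prod.case)
  qed
  then show ?thesis by (rule that)
qed

lemma exists_exponent_of_degree: "\<exists>b :: 'v \<Rightarrow>\<^sub>0 nat. weight (\<lambda>_. 1) b = weight (\<lambda>_. 1) m"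
proof -
  let ?d = "\<Sum>v\<in>keys m. lookup m v"
  fix j :: 'v
  have "weight (\<lambda>_. 1) (single j ?d) = real ?d" by (cases "?d = 0") (simp_all add: weight_def)
  then show ?thesis by (intro exI[of _ "single j ?d"]) (simp add: weight_def)
qed

text \<open>
  Multiplying by a monomial of equal degree in the other set of variables brings a monomial into the
  image of the Segre homomorphism, where it can be lifted.
\<close>

lemma initial_segre_ideal_contains_monomial:
  assumes I: "homogeneous_ideal I" and J: "homogeneous_ideal J"
    and m: "weight (\<lambda>_. 1) a = weight (\<lambda>_. 1) b"
    and "monom_poly a \<in> initial_ideal u I \<or> monom_poly b \<in> initial_ideal v J"
  shows "segre_weight u v \<notin> Trop (segre_ideal I J)"
proof -
  let ?S = "sum_ideal (initial_ideal u I) (initial_ideal v J)" and ?m = "inl_exp a + inr_exp b"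
  have "left_incl (monom_poly a) * right_incl (monom_poly b) \<in> ?S"
    using assms(4) ideal_mult[OF ideal_sum_ideal right_incl_in_sum_ideal]
      ideal_mult_right[OF ideal_sum_ideal left_incl_in_sum_ideal] by blast
  then have "single ?m 1 \<in> ?S"
    by (simp add: monom_poly_def left_incl_single right_incl_single mult_single)
  then have *: "segre_lift (single ?m 1) \<in> initial_ideal (segre_weight u v) (segre_ideal I J)"
    by (rule segre_lift_initial[OF I J])
  have "weight (\<lambda>_. - 1) b = - weight (\<lambda>_. 1) b"
    by (simp add: weight_def sum_negf)
  then have "weight bidegree_diff ?m = 0"
    using m by (simp add: bidegree_diff_def weight_add inl_exp_def inr_exp_def weight_of_exp_map
        weight_single del: One_nat_def)
  then have "monom_poly (segre_lift_exp ?m) \<in> initial_ideal (segre_weight u v) (segre_ideal I J)"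
    using * by (simp add: segre_lift_single monom_poly_def)
  then show ?thesis by (auto simp: Trop_def)
qed

lemma Trop_segre_factors:
  assumes I: "homogeneous_ideal I" and J: "homogeneous_ideal J"
    and w: "segre_weight u v \<in> Trop (segre_ideal I J)"
  shows "u \<in> Trop I" "v \<in> Trop J"
proof -
  show "u \<in> Trop I"
    unfolding Trop_def
  proof (intro CollectI allI notI)
    fix m assume m: "monom_poly m \<in> initial_ideal u I"
    obtain b :: "'b \<Rightarrow>\<^sub>0 nat" where "weight (\<lambda>_. 1) b = weight (\<lambda>_. 1) m"
      using exists_exponent_of_degree by blast
    then show False using initial_segre_ideal_contains_monomial[OF I J, of m b] m w by simp
  qed
  show "v \<in> Trop J"
    unfolding Trop_def
  proof (intro CollectI allI notI)
    fix m assume m: "monom_poly m \<in> initial_ideal v J"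
    obtain a :: "'a \<Rightarrow>\<^sub>0 nat" where "weight (\<lambda>_. 1) a = weight (\<lambda>_. 1) m"
      using exists_exponent_of_degree by blast
    then show False using initial_segre_ideal_contains_monomial[OF I J, of a m] m w by simp
  qed
qed

theorem corollary3p3:
  fixes I :: "'n::finite cpoly set" and J :: "'m::finite cpoly set"
  assumes "well_poised_variety I" and "normal_variety I"
    and "well_poised_variety J" and "normal_variety J"
  shows "well_poised_variety (segre_ideal I J)"
proof -
  have I: "homogeneous_ideal I" "primeideal I cpoly_ring" "\<And>i. var_poly i \<notin> I"
      "\<And>u. u \<in> Trop I \<Longrightarrow> primeideal (initial_ideal u I) cpoly_ring"
    using assms(1) by (auto simp: well_poised_variety_def well_poised_def)
  have J: "homogeneous_ideal J" "primeideal J cpoly_ring" "\<And>j. var_poly j \<notin> J"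
      "\<And>v. v \<in> Trop J \<Longrightarrow> primeideal (initial_ideal v J) cpoly_ring"
    using assms(3) by (auto simp: well_poised_variety_def well_poised_def)
  have "var_poly p \<notin> segre_ideal I J" for p
  proof -
    obtain i j where p: "p = (i, j)" by fastforce
    have "segre_subst (var_poly p) = left_incl (var_poly i) * right_incl (var_poly j)"
      by (simp add: segre_subst_def poly_subst_simps p)
    then show ?thesis
      using tensor_notin_sum_ideal[OF I(2) J(2) I(3) J(3)] by (simp add: segre_ideal_iff)
  qed
  moreover have "primeideal (initial_ideal w (segre_ideal I J)) cpoly_ring"
    if w: "w \<in> Trop (segre_ideal I J)" for w
  proof -
    obtain u v where uv: "w = segre_weight u v" by (rule Trop_segre_weight[OF w])
    then have "u \<in> Trop I" "v \<in> Trop J" using Trop_segre_factors[OF I(1) J(1)] w by auto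
    then show ?thesis
      unfolding uv initial_segre_ideal[OF I(1) J(1)] by (intro primeideal_segre_ideal I J)
  qed
  ultimately show ?thesis
    unfolding well_poised_variety_def well_poised_def
    using homogeneous_segre_ideal[OF I(1) J(1)] primeideal_segre_ideal[OF I(2) J(2)] by blast
qed

end
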